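(* Let $D$ be an oriented knot diagram in the plane, endowed with the checkerboard coloring of its complementary regions in which the unbounded region is shaded. Let $b$ be the number of shaded regions and let $m$ be the number of all complementary regions. Order the regions as $R_1,\dots,R_m$ so that $R_1,\dots,R_b$ are exactly the shaded regions, and let $M_D$ be the Dehn coloring matrix of $D$ with respect to this ordering, so that its $j$-th column corresponds to $R_j$. Let $G$ be the $b\times b$ Goeritz matrix of $D$, with rows and columns indexed by $R_1,\dots,R_b$ in the same order. For each $j\in\{1,\dots,b\}$, take the rows of $M_D$ whose $j$-th entry is nonzero, multiply each of these rows by $+1$ or $-1$ so that the $j$-th entry of the resulting row equals the negative of the Goeritz index of the crossing of $D$ corresponding to that row, and let $v_j\in\mathbb{Z}^m$ be the sum of the resulting rows. Let $N$ be the $b\times m$ matrix whose $j$-th row is $v_j$. Then the $b\times b$ submatrix of $N$ formed by its first $b$ columns is equal to the Goeritz matrix $G$, and all entries of $N$ in columns $b+1,\dots,m$ are zero.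
   Context: A checkerboard coloring of a knot diagram shades some of its complementary regions so that, of any two regions adjacent along an arc of the diagram, exactly one is shaded. The coloring used here is always the one in which the unbounded region is shaded. Goeritz index: each crossing of $D$ is assigned $+1$ or $-1$ depending on the position of the shaded regions around it. The index is $+1$ if rotating the over-strand counterclockwise about the crossing until it coincides with the under-strand sweeps over the shaded corners at the crossing, and $-1$ if this rotation sweeps over the unshaded corners. Goeritz matrix: let the shaded regions be $B_1,\dots,B_b$. For $j\neq k$, let $c_{jk}$ be the sum of the Goeritz indices of the crossings at which $B_j$ and $B_k$ meet (the sum is $0$ if there are none). The Goeritz matrix is the $b\times b$ integer matrix $G=(g_{jk})$ with $g_{jk}=c_{jk}$ for $j\neq k$ and $g_{jj}=-\sum_{\ell\neq j}c_{j\ell}$. (No row or column is deleted.) Dehn coloring matrix: let $R_1,\dots,R_m$ be the complementary regions of $D$, with variables $Z_1,\dots,Z_m$. Each crossing gives an equation $Z_i+Z_j-Z_k-Z_l=0$, where $R_i,R_j,R_k,R_l$ are the regions at the four corners of the crossing in cyclic order. Here $R_i$ and $R_j$ are the two regions lying ahead of the under-strand when one travels along the oriented over-strand (they are separated from each other by the over-strand), and $R_k$ and $R_l$ are the two regions on the other side of the under-strand, so that $R_i$ is opposite to $R_k$ and $R_j$ is opposite to $R_l$. If the same region occupies more than one corner, its coefficients are added. The Dehn coloring matrix $M_D$ is the coefficient matrix of this system: its rows correspond to the crossings of $D$ and its columns to the regions $R_1,\dots,R_m$. *)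

theory Defs
  imports "HOL-Analysis.Analysis" "Jordan_Normal_Form.DL_Submatrix"
begin

section \<open>Oriented knot diagrams in the plane\<close>

text \<open>
  A diagram is a closed plane curve, parametrized with period 1 (the direction of the parameter
  is the orientation), together with its crossings. A crossing \<open>(s, t)\<close> records the two parameters
  in \<open>[0,1)\<close> at which the curve runs through the double point: \<open>s\<close> on the over-strand, \<open>t\<close> on
  the under-strand. A diagram without crossings is allowed.
\<close>

record knot_diagram =
  curve :: "real \<Rightarrow> complex"
  crossings :: "(real \<times> real) set"

definition velocity :: "knot_diagram \<Rightarrow> real \<Rightarrow> complex" where
  "velocity D t = vector_derivative (curve D) (at t)"

text \<open>
  The condition \<open>Im (cnj u * v) \<noteq> 0\<close> says that \<open>u\<close> and \<open>v\<close> are linearly independent over the reals;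
  \<open>Im (cnj u * v) > 0\<close> says that moreover \<open>v\<close> lies counterclockwise of \<open>u\<close>.
\<close>

definition oriented_knot_diagram :: "knot_diagram \<Rightarrow> bool" where
  "oriented_knot_diagram D \<longleftrightarrow>
     (\<forall>t. curve D (t + 1) = curve D t) \<and>
     curve D C1_differentiable_on UNIV \<and>
     (\<forall>t. velocity D t \<noteq> 0) \<and>
     finite (crossings D) \<and>
     (\<forall>(s, t) \<in> crossings D.
        s \<in> {0..<1} \<and> t \<in> {0..<1} \<and> s \<noteq> t \<and> curve D s = curve D t \<and>
        Im (cnj (velocity D s) * velocity D t) \<noteq> 0) \<and>
     (\<forall>s \<in> {0..<1}. \<forall>t \<in> {0..<1}. s \<noteq> t \<and> curve D s = curve D t \<longrightarrow>
        ((s, t) \<in> crossings D) \<noteq> ((t, s) \<in> crossings D)) \<and>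
     (\<forall>r \<in> {0..<1}. \<forall>s \<in> {0..<1}. \<forall>t \<in> {0..<1}.
        curve D r = curve D s \<and> curve D s = curve D t \<longrightarrow> r = s \<or> s = t \<or> r = t)"

definition regions :: "knot_diagram \<Rightarrow> complex set set" where
  "regions D = components (- range (curve D))"

text \<open>
  The region entered when one leaves the point \<open>p\<close> of the diagram in direction \<open>d\<close>. It exists
  whenever \<open>d\<close> is not tangent to a strand through \<open>p\<close>.
\<close>

definition region_towards :: "knot_diagram \<Rightarrow> complex \<Rightarrow> complex \<Rightarrow> complex set" where
  "region_towards D p d =
     (THE A. A \<in> regions D \<and> eventually (\<lambda>\<epsilon>. p + of_real \<epsilon> * d \<in> A) (at_right 0))"


section \<open>Checkerboard colorings\<close>

text \<open>
  Two regions are adjacent along an arc of the diagram if they are the regions on the two sides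
  of the curve at some point that is not a double point.
\<close>

definition adjacent :: "knot_diagram \<Rightarrow> complex set \<Rightarrow> complex set \<Rightarrow> bool" where
  "adjacent D A B \<longleftrightarrow>
     (\<exists>t. curve D t \<notin> (\<lambda>x. curve D (fst x)) ` crossings D \<and>
          {A, B} = {region_towards D (curve D t) (\<i> * velocity D t),
                    region_towards D (curve D t) (- \<i> * velocity D t)})"

text \<open>\<open>S\<close> is the set of shaded regions.\<close>

definition checkerboard_coloring :: "knot_diagram \<Rightarrow> complex set set \<Rightarrow> bool" where
  "checkerboard_coloring D S \<longleftrightarrow>
     S \<subseteq> regions D \<and>
     (\<forall>A \<in> regions D. \<forall>B \<in> regions D. adjacent D A B \<longrightarrow> (A \<in> S) \<noteq> (B \<in> S)) \<and>
     (\<forall>A \<in> regions D. \<not> bounded A \<longrightarrow> A \<in> S)"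


section \<open>Crossings and their corners\<close>

definition over_dir :: "knot_diagram \<Rightarrow> real \<times> real \<Rightarrow> complex" where
  "over_dir D x = velocity D (fst x)"

definition under_dir :: "knot_diagram \<Rightarrow> real \<times> real \<Rightarrow> complex" where
  "under_dir D x = velocity D (snd x)"

text \<open>
  With \<open>u\<close> and \<open>v\<close> the directions of the two strands, the four corners at a crossing lie in the
  directions \<open>u + v\<close>, \<open>u - v\<close>, \<open>- u - v\<close>, \<open>- u + v\<close>, in this cyclic order up to reversal.
\<close>

definition corner :: "knot_diagram \<Rightarrow> real \<times> real \<Rightarrow> complex \<Rightarrow> complex set" where
  "corner D x d = region_towards D (curve D (fst x)) d"

definition corner_regions :: "knot_diagram \<Rightarrow> real \<times> real \<Rightarrow> complex set set" where
  "corner_regions D x =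
     (let u = over_dir D x; v = under_dir D x
      in corner D x ` {u + v, u - v, - u - v, - u + v})"


section \<open>Goeritz index and Goeritz matrix\<close>

text \<open>
  The counterclockwise rotation of the line spanned by \<open>u\<close> onto the line spanned by \<open>v\<close> takes \<open>u\<close>
  to the direction of \<open>w\<close>, where \<open>w\<close> is the one of \<open>v\<close>, \<open>- v\<close> lying counterclockwise of \<open>u\<close>. It
  sweeps over the corner between \<open>u\<close> and \<open>w\<close> and the opposite one.
\<close>

definition swept_regions :: "knot_diagram \<Rightarrow> real \<times> real \<Rightarrow> complex set set" where
  "swept_regions D x =
     (let u = over_dir D x; v = under_dir D x;
          w = (if Im (cnj u * v) > 0 then v else - v)
      in corner D x ` {u + w, - u - w})"

definition goeritz_index :: "knot_diagram \<Rightarrow> complex set set \<Rightarrow> real \<times> real \<Rightarrow> int" where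
  "goeritz_index D S x = (if swept_regions D x \<subseteq> S then 1 else - 1)"

definition goeritz_coeff ::
    "knot_diagram \<Rightarrow> complex set set \<Rightarrow> complex set \<Rightarrow> complex set \<Rightarrow> int" where
  "goeritz_coeff D S A B =
     (\<Sum>x | x \<in> crossings D \<and> A \<in> corner_regions D x \<and> B \<in> corner_regions D x.
        goeritz_index D S x)"

text \<open>\<open>Bs\<close> lists the shaded regions; indices start at 0.\<close>

definition goeritz_matrix ::
    "knot_diagram \<Rightarrow> complex set set \<Rightarrow> complex set list \<Rightarrow> int mat" where
  "goeritz_matrix D S Bs =
     Matrix.mat (length Bs) (length Bs) (\<lambda>(j, k).
       if j = k then - (\<Sum>l \<in> {..<length Bs} - {j}. goeritz_coeff D S (Bs ! j) (Bs ! l))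
       else goeritz_coeff D S (Bs ! j) (Bs ! k))"


section \<open>Dehn coloring matrix\<close>

text \<open>
  The coefficient of the variable of \<open>A\<close> in the equation of \<open>x\<close>. The corners ahead of the
  under-strand, seen along the oriented over-strand, are those with a positive \<open>u\<close>-component.
\<close>

definition dehn_coeff :: "knot_diagram \<Rightarrow> real \<times> real \<Rightarrow> complex set \<Rightarrow> int" where
  "dehn_coeff D x A =
     (let u = over_dir D x; v = under_dir D x
      in of_bool (corner D x (u + v) = A) + of_bool (corner D x (u - v) = A)
         - of_bool (corner D x (- u - v) = A) - of_bool (corner D x (- u + v) = A))"

definition dehn_matrix ::
    "knot_diagram \<Rightarrow> (real \<times> real) list \<Rightarrow> complex set list \<Rightarrow> int mat" where
  "dehn_matrix D Xs Rs =
     Matrix.mat (length Xs) (length Rs) (\<lambda>(i, j). dehn_coeff D (Xs ! i) (Rs ! j))"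


section \<open>Signed sums of rows\<close>

text \<open>The sign by which \<open>a\<close> has to be multiplied to give \<open>c\<close>; it is unique for \<open>a \<noteq> 0\<close>.\<close>

definition sign_to :: "int \<Rightarrow> int \<Rightarrow> int" where
  "sign_to a c = (THE \<sigma>. \<sigma> \<in> {1, - 1} \<and> \<sigma> * a = c)"

definition signed_row_sum ::
    "knot_diagram \<Rightarrow> complex set set \<Rightarrow> (real \<times> real) list \<Rightarrow> complex set list \<Rightarrow> nat \<Rightarrow> int vec" where
  "signed_row_sum D S Xs Rs j =
     (let M = dehn_matrix D Xs Rs
      in Matrix.vec (length Rs) (\<lambda>k.
           \<Sum>i | i < length Xs \<and> M $$ (i, j) \<noteq> 0.
             sign_to (M $$ (i, j)) (- goeritz_index D S (Xs ! i)) * M $$ (i, k)))"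

end

theory Submission
  imports Defs
begin

text \<open>
  At every crossing the two shaded corners are opposite and enter the Dehn equation with opposite
  signs. Writing \<open>g\<close> for the Goeritz index and \<open>d\<close> for the Dehn coefficients, the entry of \<open>N\<close> at
  \<open>(j, k)\<close> is therefore minus the sum over all crossings \<open>x\<close> of \<open>g x * d x R\<^sub>j * d x R\<^sub>k\<close>. For \<open>j \<noteq> k\<close>
  both shaded this is the Goeritz coefficient, and the shaded entries of each row of \<open>M\<^sub>D\<close> add up
  to 0, which gives the diagonal. For an unshaded \<open>R\<^sub>k\<close>, follow the curve and record \<open>1\<close>, \<open>- 1\<close> or
  \<open>0\<close> according as it has \<open>R\<^sub>j\<close> on the left and \<open>R\<^sub>k\<close> on the right, the reverse, or neither. This
  periodic function is constant between crossings, and its two jumps at a crossing \<open>x\<close> add up to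
  \<open>g x * d x R\<^sub>j * d x R\<^sub>k\<close>; the jumps over one period cancel.
\<close>

text \<open>The factors \<open>1\<close> and \<open>- 1\<close> make both filters instances of one shift \<open>a + \<sigma> * h\<close>.\<close>

lemma eventually_at_right_shift:
  "eventually P (at_right a) \<longleftrightarrow> eventually (\<lambda>h. P (a + 1 * h)) (at_right (0::real))"
  by (subst eventually_at_right_to_0) (simp add: add.commute)

lemma eventually_at_left_shift:
  "eventually P (at_left a) \<longleftrightarrow> eventually (\<lambda>h. P (a + - 1 * h)) (at_right (0::real))"
  by (simp add: eventually_at_left_to_right eventually_at_right_to_0[of _ "- a"])


section \<open>Jumps of piecewise constant functions\<close>

lemma locally_const_on_interval:
  fixes F :: "real \<Rightarrow> 'b"
  assumes "a \<le> b" and "\<And>t. t \<in> {a..b} \<Longrightarrow> eventually (\<lambda>\<tau>. F \<tau> = F t) (nhds t)"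
  shows "F b = F a"
proof (rule connected_local_const[of "{a..b}", THEN sym])
  show "\<forall>t\<in>{a..b}. eventually (\<lambda>\<tau>. F t = F \<tau>) (at t within {a..b})"
    using assms(2) by (auto simp: eventually_at_filter intro!: eventually_mono[OF assms(2)])
qed (use assms(1) in auto)

text \<open>Between consecutive jump points \<open>F\<close> is constant, so the sum telescopes. The
  induction strips off the largest jump point \<open>p\<close>; the right end \<open>b\<close> stays
  arbitrary because the induction hypothesis is applied to a point \<open>b0\<close> just left of
  \<open>p\<close>.\<close>

lemma sum_jumps:
  fixes F :: "real \<Rightarrow> 'b :: ab_group_add"
  assumes "finite P" and "a < b" and "P \<subseteq> {a<..<b}"
    and "\<And>t. t \<in> {a..b} - P \<Longrightarrow> eventually (\<lambda>\<tau>. F \<tau> = F t) (nhds t)"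
    and "\<And>t. t \<in> P \<Longrightarrow> eventually (\<lambda>\<tau>. F \<tau> = R t) (at_right t)"
    and "\<And>t. t \<in> P \<Longrightarrow> eventually (\<lambda>\<tau>. F \<tau> = L t) (at_left t)"
  shows "(\<Sum>t\<in>P. R t - L t) = F b - F a"
  using assms
proof (induction P arbitrary: b rule: finite_linorder_max_induct)
  case empty
  then show ?case using locally_const_on_interval[of a b F] by auto
next
  case (insert p P)
  obtain b1 where b1: "b1 > p" "b1 < b" "F b1 = R p"
  proof -
    have "eventually (\<lambda>\<tau>. F \<tau> = R p \<and> \<tau> < b \<and> \<tau> > p) (at_right p)"
      using insert by (intro eventually_conj eventually_at_right_less) (auto simp: eventually_at_right_field)
    then show ?thesis
      using that by (metis (mono_tags, lifting) eventually_happens' trivial_limit_at_right_real)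
  qed
  have "F b = F b1"
  proof (rule locally_const_on_interval)
    show "eventually (\<lambda>\<tau>. F \<tau> = F t) (nhds t)" if "t \<in> {b1..b}" for t
      using that b1 insert.hyps insert.prems by (intro insert.prems(3)) fastforce
  qed (use b1 in simp)
  \<comment> \<open>\<open>b0\<close> has to lie to the right of \<open>a\<close> and of all
    remaining jump points; inserting \<open>a\<close> also covers the case that none
    remains.\<close>
  define q where "q = Max (insert a P)"
  have q: "q < p" "a \<le> q" "\<And>t. t \<in> P \<Longrightarrow> t \<le> q"
    using insert by (auto simp: q_def)
  obtain b0 where b0: "b0 < p" "b0 > q" "F b0 = L p"
  proof -
    have "eventually (\<lambda>\<tau>. F \<tau> = L p \<and> \<tau> > q \<and> \<tau> < p) (at_left p)"
      using insert.prems(5)[of p] eventually_at_left_real[OF q(1)] by (auto elim: eventually_elim2)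
    then show ?thesis
      using that by (metis (mono_tags, lifting) eventually_happens' trivial_limit_at_left_real)
  qed
  have "(\<Sum>t\<in>P. R t - L t) = F b0 - F a"
  proof (rule insert.IH)
    show "P \<subseteq> {a<..<b0}" using insert.prems q b0 by fastforce
    show "eventually (\<lambda>\<tau>. F \<tau> = F t) (nhds t)" if "t \<in> {a..b0} - P" for t
      using that b0 insert.prems by (intro insert.prems(3)) auto
  qed (use q b0 insert.prems in auto)
  moreover have "p \<notin> P" using insert by auto
  ultimately show ?case
    using insert.hyps \<open>F b = F b1\<close> b1 b0 by simp
qed


section \<open>The local picture of a diagram\<close>

text \<open>The determinant of the pair \<open>u\<close>, \<open>v\<close>, that is, the signed area
  of the parallelogram they span.\<close>

definition wedge :: "complex \<Rightarrow> complex \<Rightarrow> real" where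
  "wedge u v = Im (cnj u * v)"

lemma wedge_add_right: "wedge u (v + w) = wedge u v + wedge u w"
  and wedge_diff_right: "wedge u (v - w) = wedge u v - wedge u w"
  and wedge_scale_right: "wedge u (of_real r * v) = r * wedge u v"
  and wedge_minus_right: "wedge u (- v) = - wedge u v"
  and wedge_self: "wedge u u = 0"
  and wedge_swap: "wedge v u = - wedge u v"
  and wedge_ii: "wedge u (\<i> * u) = (norm u)\<^sup>2"
  unfolding wedge_def cmod_def
  by (auto simp: algebra_simps power2_eq_square)

lemma abs_wedge_le: "\<bar>wedge u v\<bar> \<le> norm u * norm v"
  unfolding wedge_def using abs_Im_le_cmod[of "cnj u * v"] by (simp add: norm_mult)

lemma bounded_linear_wedge: "bounded_linear (wedge u)"
  by (rule bounded_linear_intro[where K = "norm u"])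
     (simp_all add: wedge_add_right scaleR_conv_of_real wedge_scale_right
        mult.commute[of "norm _" "norm u"] abs_wedge_le)

lemma continuous_on_wedge [continuous_intros]:
  "continuous_on A f \<Longrightarrow> continuous_on A g \<Longrightarrow> continuous_on A (\<lambda>x. wedge (f x) (g x))"
  unfolding wedge_def by (intro continuous_intros)

text \<open>Two regions that both contain \<open>p + of_real \<epsilon> * d\<close> for all small
  \<epsilon> meet, and components that meet coincide.\<close>

lemma region_towards_eqI:
  assumes "A \<in> regions D" and ev: "eventually (\<lambda>\<epsilon>. p + of_real \<epsilon> * d \<in> A) (at_right 0)"
  shows "region_towards D p d = A"
  unfolding region_towards_def
proof (rule the_equality)
  fix B assume B: "B \<in> regions D \<and> eventually (\<lambda>\<epsilon>. p + of_real \<epsilon> * d \<in> B) (at_right 0)"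
  with ev have "eventually (\<lambda>\<epsilon>. p + of_real \<epsilon> * d \<in> A \<and> p + of_real \<epsilon> * d \<in> B) (at_right 0)"
    by (intro eventually_conj) auto
  then have "A \<inter> B \<noteq> {}"
    by (metis (no_types, lifting) IntI empty_iff eventually_happens' trivial_limit_at_right_real)
  then show "B = A"
    using assms(1) B unfolding regions_def by (metis components_eq)
qed (use assms in auto)

lemma connected_in_region:
  assumes "connected T" and "T \<noteq> {}" and "T \<inter> range (curve D) = {}"
  obtains A where "A \<in> regions D" and "T \<subseteq> A"
  using exists_component_superset[of T "- range (curve D)"] assms unfolding regions_def by blast

section \<open>The curve and its parameters over a point\<close>

locale diagram =
  fixes D :: knot_diagram
  assumes diagram: "oriented_knot_diagram D"
begin

abbreviation \<gamma> where "\<gamma> \<equiv> curve D"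
abbreviation \<gamma>' where "\<gamma>' \<equiv> velocity D"

lemma has_velocity: "(\<gamma> has_vector_derivative \<gamma>' t) (at t)"
  and continuous_velocity: "continuous_on UNIV \<gamma>'"
proof -
  have "\<gamma> C1_differentiable_on UNIV"
    using diagram unfolding oriented_knot_diagram_def by blast
  then obtain g where g: "\<And>t. (\<gamma> has_vector_derivative g t) (at t)" "continuous_on UNIV g"
    unfolding C1_differentiable_on_def by auto
  then have "\<gamma>' = g"
    by (auto simp: velocity_def vector_derivative_at)
  with g show "(\<gamma> has_vector_derivative \<gamma>' t) (at t)" "continuous_on UNIV \<gamma>'" by auto
qed

lemma continuous_curve: "continuous_on A \<gamma>"
  by (meson continuous_at_imp_continuous_on has_vector_derivative_continuous has_velocity)

lemma velocity_nonzero: "\<gamma>' t \<noteq> 0"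
  using diagram unfolding oriented_knot_diagram_def by blast

lemma curve_periodic_1: "\<gamma> (t + 1) = \<gamma> t"
  using diagram unfolding oriented_knot_diagram_def by blast

lemma velocity_periodic: "\<gamma>' (t + 1) = \<gamma>' t"
proof -
  have "((\<gamma> \<circ> (\<lambda>x. x + 1)) has_vector_derivative 1 *\<^sub>R \<gamma>' (t + 1)) (at t)"
    by (rule vector_diff_chain_at) (auto intro!: derivative_eq_intros has_velocity)
  moreover have "\<gamma> \<circ> (\<lambda>x. x + 1) = \<gamma>" by (auto simp: curve_periodic_1)
  ultimately show ?thesis
    using has_velocity[of t] by (metis scaleR_one vector_derivative_unique_at)
qed

lemma curve_periodic: "\<gamma> (t + of_int k) = \<gamma> t"
proof (induction k arbitrary: t rule: int_induct[of _ 0])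
  case (step1 i)
  have "\<gamma> (t + of_int (i + 1)) = \<gamma> ((t + 1) + of_int i)" by (simp add: algebra_simps)
  then show ?case by (simp only: step1 curve_periodic_1)
next
  case (step2 i)
  have "\<gamma> (t + of_int (i - 1)) = \<gamma> ((t - 1) + of_int i)" by (simp add: algebra_simps)
  then show ?case using curve_periodic_1[of "t - 1"] by (simp only: step2) simp
qed auto

text \<open>\<open>P\<close> represents, modulo the period 1, all parameters over \<open>p\<close>.
  The representatives may lie outside [0,1), so the base point of the parametrization needs no
  separate treatment.\<close>

definition preimages :: "real set \<Rightarrow> complex \<Rightarrow> bool" where
  "preimages P p \<longleftrightarrow> (\<forall>s\<in>P. \<gamma> s = p) \<and> (\<forall>\<sigma>. \<gamma> \<sigma> = p \<longrightarrow> (\<exists>k::int. \<sigma> - of_int k \<in> P))"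

text \<open>The parameters around which \<open>Q\<close> holds form an open set \<open>V\<close>.
  The rest of a period has compact image, which misses \<open>p\<close> because \<open>V\<close>
  contains every parameter over \<open>p\<close>. Thus facts about the strands through
  \<open>p\<close> control all diagram points near \<open>p\<close>.\<close>

lemma eventually_near_preimages:
  assumes P: "preimages P p" and ev: "\<And>s. s \<in> P \<Longrightarrow> eventually (\<lambda>\<sigma>. Q (\<gamma> \<sigma>)) (nhds s)"
  shows "eventually (\<lambda>q. q \<in> range \<gamma> \<longrightarrow> Q q) (nhds p)"
proof -
  define V where "V = {\<sigma>. eventually (\<lambda>\<sigma>. Q (\<gamma> \<sigma>)) (nhds \<sigma>)}"
  have "open V"
    unfolding V_def by (subst open_subopen) (smt (verit) eventually_nhds mem_Collect_eq subsetI)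
  have "compact ({0..1} - V)"
    using \<open>open V\<close> by (intro compact_diff) auto
  then have "closed (\<gamma> ` ({0..1} - V))"
    by (intro compact_imp_closed compact_continuous_image continuous_curve)
  moreover have "p \<notin> \<gamma> ` ({0..1} - V)"
  proof
    assume "p \<in> \<gamma> ` ({0..1} - V)"
    then obtain \<sigma> where \<sigma>: "\<sigma> \<notin> V" "\<gamma> \<sigma> = p" by auto
    \<comment> \<open>Periodicity carries \<open>Q\<close> from a neighborhood of the representative
      over to one of \<sigma>.\<close>
    then obtain k :: int where "\<sigma> - of_int k \<in> P" using P unfolding preimages_def by blast
    then have "eventually (\<lambda>\<tau>. Q (\<gamma> \<tau>)) (nhds (\<sigma> - of_int k))" using ev by blast
    moreover have "filterlim (\<lambda>\<tau>. \<tau> - of_int k) (nhds (\<sigma> - of_int k)) (nhds \<sigma>)"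
      by (intro tendsto_intros) (simp add: filterlim_ident)
    ultimately have "eventually (\<lambda>\<tau>. Q (\<gamma> (\<tau> - of_int k))) (nhds \<sigma>)"
      by (rule eventually_compose_filterlim)
    moreover have "\<gamma> (\<tau> - of_int k) = \<gamma> \<tau>" for \<tau>
      using curve_periodic[of \<tau> "- k"] by simp
    ultimately show False using \<sigma> by (simp add: V_def)
  qed
  ultimately have "eventually (\<lambda>q. q \<notin> \<gamma> ` ({0..1} - V)) (nhds p)"
    using eventually_nhds_in_open[of "- \<gamma> ` ({0..1} - V)" p] by (simp add: open_Compl)
  then show ?thesis
  proof eventually_elim
    case (elim q)
    show ?case
    proof
      assume "q \<in> range \<gamma>"
      then obtain \<sigma> where "q = \<gamma> \<sigma>" by auto
      then have "q = \<gamma> (frac \<sigma>)" using curve_periodic[of \<sigma> "- \<lfloor>\<sigma>\<rfloor>"] by (simp add: frac_def)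
      moreover have "frac \<sigma> \<in> {0..1}" using frac_lt_1[of \<sigma>] by (auto intro: less_imp_le)
      ultimately have "frac \<sigma> \<in> V" using elim by auto
      then show "Q q" using \<open>q = \<gamma> (frac \<sigma>)\<close> unfolding V_def by (auto dest: eventually_nhds_x_imp_x)
    qed
  qed
qed

section \<open>Tangent cones and sectors at a point\<close>

lemma curve_linearization:
  assumes "e > 0"
  shows "eventually (\<lambda>\<sigma>. norm (\<gamma> \<sigma> - \<gamma> s - of_real (\<sigma> - s) * \<gamma>' s) \<le> e * \<bar>\<sigma> - s\<bar>) (nhds s)"
proof -
  have "(\<gamma> has_derivative (\<lambda>h. h *\<^sub>R \<gamma>' s)) (at s)"
    using has_velocity unfolding has_vector_derivative_def .
  then obtain d where "d > 0" "\<And>\<sigma>. norm (\<sigma> - s) < d \<Longrightarrow>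
      norm (\<gamma> \<sigma> - \<gamma> s - (\<sigma> - s) *\<^sub>R \<gamma>' s) \<le> e * norm (\<sigma> - s)"
    using assms unfolding has_derivative_at_alt by blast
  then show ?thesis
    by (auto simp: eventually_nhds_metric dist_real_def scaleR_conv_of_real)
qed

text \<open>The strand stays in a thin double cone around its tangent: the linear part of the chord
  has wedge 0 with the tangent, so only the linearization error counts, and this is small against
  the length of the chord.\<close>

lemma chord_nearly_tangent:
  assumes "\<eta> > 0"
  shows "eventually (\<lambda>\<sigma>. \<bar>wedge (\<gamma>' s) (\<gamma> \<sigma> - \<gamma> s)\<bar> \<le> \<eta> * norm (\<gamma> \<sigma> - \<gamma> s)) (nhds s)"
proof -
  define u where "u = \<gamma>' s"
  \<comment> \<open>The bound \<open>norm u / 2\<close> makes the chord at least half as long as its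
    linear part; the bound \<open>\<eta> / 2\<close> absorbs the resulting factor 2.\<close>
  define e where "e = min (\<eta> / 2) (norm u / 2)"
  have u: "norm u > 0" using velocity_nonzero by (simp add: u_def)
  have e: "e > 0" "2 * e \<le> \<eta>" "2 * e \<le> norm u" using assms u by (auto simp: e_def)
  show ?thesis using curve_linearization[OF e(1), of s]
  proof eventually_elim
    case (elim \<sigma>)
    define z where "z = \<gamma> \<sigma> - \<gamma> s"
    define h where "h = \<sigma> - s"
    have le: "norm (z - of_real h * u) \<le> e * \<bar>h\<bar>" using elim by (simp add: z_def h_def u_def)
    have "wedge u z = wedge u (z - of_real h * u)"
      by (simp add: wedge_diff_right wedge_scale_right wedge_self)
    then have "\<bar>wedge u z\<bar> \<le> norm u * (e * \<bar>h\<bar>)"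
      using abs_wedge_le[of u "z - of_real h * u"] le u
      by (smt (verit) mult_left_mono norm_ge_zero)
    moreover have "\<bar>h\<bar> * norm u - e * \<bar>h\<bar> \<le> norm z"
      using norm_triangle_ineq2[of "of_real h * u" "of_real h * u - z"] le
      by (simp add: norm_mult norm_minus_commute)
    then have "\<bar>h\<bar> * norm u \<le> 2 * norm z"
      using mult_right_mono[OF e(3), of "\<bar>h\<bar>"] by (simp add: algebra_simps)
    then have "e * (\<bar>h\<bar> * norm u) \<le> e * (2 * norm z)" using e by (intro mult_left_mono) auto
    moreover have "2 * e * norm z \<le> \<eta> * norm z" using e by (intro mult_right_mono) auto
    ultimately show ?case by (simp add: z_def u_def algebra_simps)
  qed
qed

text \<open>\<open>d1\<close> and \<open>d2\<close> lie on the same side of every tangent at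
  \<open>p\<close>, hence in a common open convex cone that avoids the tangents by a margin. The
  diagram near \<open>p\<close> stays close to its tangents, so the cone cut off at a small radius
  misses it and, being connected, lies in one region.\<close>

lemma sector_in_region:
  assumes P: "preimages P p" "finite P" "p \<in> range \<gamma>"
    and d: "\<And>s. s \<in> P \<Longrightarrow> wedge (\<gamma>' s) d1 * wedge (\<gamma>' s) d2 > 0"
  obtains A K r where "A \<in> regions D" "open K" "d1 \<in> K" "d2 \<in> K" "r > 0"
    "\<And>z \<epsilon>. z \<in> K \<Longrightarrow> \<epsilon> > 0 \<Longrightarrow> norm (of_real \<epsilon> * z) < r \<Longrightarrow> p + of_real \<epsilon> * z \<in> A"
proof -
  define sg where "sg s = sgn (wedge (\<gamma>' s) d1)" for s
  \<comment> \<open>The directions on the same side of each tangent as \<open>d1\<close>, outside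
    the double cone of width \<eta> to which \<open>chord_nearly_tangent\<close> confines the
    strands.\<close>
  define K where "K \<eta> = {z. \<forall>s\<in>P. \<eta> * norm z < sg s * wedge (\<gamma>' s) z}" for \<eta>
  have pos: "sg s * wedge (\<gamma>' s) d1 > 0" "sg s * wedge (\<gamma>' s) d2 > 0" if "s \<in> P" for s
    using d[OF that] by (auto simp: sg_def zero_less_mult_iff sgn_if)
  have "eventually (\<lambda>\<eta>. \<forall>s\<in>P. \<eta> * norm x < sg s * wedge (\<gamma>' s) x) (at_right 0)"
    if "x = d1 \<or> x = d2" for x
  proof (intro eventually_ball_finite ballI \<open>finite P\<close>)
    fix s assume "s \<in> P"
    have "((\<lambda>\<eta>. \<eta> * norm x) \<longlongrightarrow> 0 * norm x) (at_right 0)" by (intro tendsto_intros)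
    then show "eventually (\<lambda>\<eta>. \<eta> * norm x < sg s * wedge (\<gamma>' s) x) (at_right 0)"
      using pos[OF \<open>s \<in> P\<close>] that by (auto elim!: order_tendstoD)
  qed
  then have "eventually (\<lambda>\<eta>. d1 \<in> K \<eta> \<and> d2 \<in> K \<eta> \<and> \<eta> > 0) (at_right 0)"
    by (auto simp: K_def intro!: eventually_conj eventually_at_right_less)
  then obtain \<eta> where \<eta>: "\<eta> > 0" "d1 \<in> K \<eta>" "d2 \<in> K \<eta>"
    by (metis (no_types, lifting) eventually_happens' trivial_limit_at_right_real)
  have "P \<noteq> {}" using P unfolding preimages_def by blast
  have scale: "of_real \<epsilon> * z \<in> K \<eta>" if "z \<in> K \<eta>" "\<epsilon> > 0" for \<epsilon> z
    using that by (auto simp: K_def wedge_scale_right norm_mult mult.left_commute[of _ \<epsilon>])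
  have "eventually (\<lambda>q. q \<in> range \<gamma> \<longrightarrow> (\<exists>s\<in>P. \<bar>wedge (\<gamma>' s) (q - p)\<bar> \<le> \<eta> * norm (q - p))) (nhds p)"
  proof (rule eventually_near_preimages[OF P(1)])
    fix s assume "s \<in> P"
    then have "\<gamma> s = p" using P by (auto simp: preimages_def)
    with chord_nearly_tangent[OF \<open>\<eta> > 0\<close>, of s] \<open>s \<in> P\<close>
    show "eventually (\<lambda>\<sigma>. \<exists>s\<in>P. \<bar>wedge (\<gamma>' s) (\<gamma> \<sigma> - p)\<bar> \<le> \<eta> * norm (\<gamma> \<sigma> - p)) (nhds s)"
      by (auto elim: eventually_mono)
  qed
  then obtain r where r: "r > 0" "\<And>q. dist q p < r \<Longrightarrow> q \<in> range \<gamma> \<Longrightarrow>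
      \<exists>s\<in>P. \<bar>wedge (\<gamma>' s) (q - p)\<bar> \<le> \<eta> * norm (q - p)"
    unfolding eventually_nhds_metric by blast
  define T where "T = (+) p ` (K \<eta> \<inter> ball 0 r)"
  have "convex (K \<eta>)"
  proof (rule convexI)
    fix x y :: complex and a b :: real
    assume *: "x \<in> K \<eta>" "y \<in> K \<eta>" "0 \<le> a" "0 \<le> b" "a + b = 1"
    show "a *\<^sub>R x + b *\<^sub>R y \<in> K \<eta>"
      unfolding K_def
    proof safe
      fix s assume s: "s \<in> P"
      have "norm (a *\<^sub>R x + b *\<^sub>R y) \<le> a * norm x + b * norm y"
        using * norm_triangle_ineq[of "a *\<^sub>R x" "b *\<^sub>R y"] by simp
      from mult_left_mono[OF this, of \<eta>]
      have "\<eta> * norm (a *\<^sub>R x + b *\<^sub>R y) \<le> a * (\<eta> * norm x) + b * (\<eta> * norm y)"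
        using \<eta>(1) by (simp add: algebra_simps)
      also have "\<dots> < a * (sg s * wedge (\<gamma>' s) x) + b * (sg s * wedge (\<gamma>' s) y)"
      proof -
        have "\<eta> * norm x < sg s * wedge (\<gamma>' s) x" "\<eta> * norm y < sg s * wedge (\<gamma>' s) y"
          using * s by (auto simp: K_def)
        \<comment> \<open>If \<open>a = 0\<close>, then \<open>b = 1\<close> and strictness comes
          from \<open>y\<close>; otherwise the first summand is already strict.\<close>
        then show ?thesis using *
          by (cases "a = 0") (auto intro!: add_less_le_mono mult_strict_left_mono mult_left_mono)
      qed
      also have "\<dots> = sg s * wedge (\<gamma>' s) (a *\<^sub>R x + b *\<^sub>R y)"
        by (simp only: scaleR_conv_of_real wedge_add_right wedge_scale_right) (simp add: algebra_simps)
      finally show "\<eta> * norm (a *\<^sub>R x + b *\<^sub>R y) < sg s * wedge (\<gamma>' s) (a *\<^sub>R x + b *\<^sub>R y)" .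
    qed
  qed
  then have "connected T"
    unfolding T_def by (intro convex_connected convex_translation convex_Int convex_ball)
  moreover have "T \<inter> range \<gamma> = {}"
  proof -
    have False if "z \<in> K \<eta>" "norm z < r" "p + z \<in> range \<gamma>" for z
    proof -
      obtain s where s: "s \<in> P" "\<bar>wedge (\<gamma>' s) z\<bar> \<le> \<eta> * norm z"
      proof -
        have "\<exists>s\<in>P. \<bar>wedge (\<gamma>' s) z\<bar> \<le> \<eta> * norm z"
          using r(2)[of "p + z"] \<open>norm z < r\<close> \<open>p + z \<in> range \<gamma>\<close> by (simp add: dist_norm)
        then show ?thesis using that by blast
      qed
      have "\<bar>sg s * wedge (\<gamma>' s) z\<bar> \<le> \<bar>wedge (\<gamma>' s) z\<bar>"
        by (auto simp: sg_def sgn_if abs_mult)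
      then show False using s that unfolding K_def by fastforce
    qed
    then show ?thesis unfolding T_def by (auto simp: dist_norm) (metis rangeI)
  qed
  moreover have "T \<noteq> {}"
  proof -
    define e where "e = r / (2 * (norm d1 + 1))"
    have n: "norm d1 + 1 > 0" using norm_ge_zero[of d1] by linarith
    then have "e > 0" using r by (simp add: e_def)
    moreover have "norm (of_real e * d1) < r"
    proof -
      have "e * norm d1 \<le> e * (norm d1 + 1)" using \<open>e > 0\<close> by simp
      also have "\<dots> = r / 2" using n by (simp add: e_def field_simps)
      finally show ?thesis using r(1) \<open>e > 0\<close> by (simp add: norm_mult)
    qed
    ultimately have "of_real e * d1 \<in> K \<eta> \<inter> ball 0 r" using scale[OF \<eta>(2)] by simp
    then show ?thesis unfolding T_def by blast
  qed
  ultimately obtain A where A: "A \<in> regions D" "T \<subseteq> A"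
    using connected_in_region by metis
  moreover have "open (K \<eta>)"
  proof -
    have "K \<eta> = (\<Inter>s\<in>P. {z. \<eta> * norm z < sg s * wedge (\<gamma>' s) z})" by (auto simp: K_def)
    then show ?thesis using \<open>finite P\<close>
      by (auto intro!: open_INT open_Collect_less continuous_intros)
  qed
  ultimately show ?thesis
    using that[of A "K \<eta>" r] \<eta> r(1) scale by (force simp: T_def)
qed

lemma region_towards_sector:
  assumes A: "A \<in> regions D" and "open K" and "d \<in> K" and "r > 0"
    and K: "\<And>z \<epsilon>. z \<in> K \<Longrightarrow> \<epsilon> > 0 \<Longrightarrow> norm (of_real \<epsilon> * z) < r \<Longrightarrow> p + of_real \<epsilon> * z \<in> A"
  shows "region_towards D p d = A"
proof (rule region_towards_eqI[OF A])
  have "((\<lambda>\<epsilon>. norm (of_real \<epsilon> * d)) \<longlongrightarrow> norm (of_real 0 * d)) (at_right 0)"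
    by (intro tendsto_intros)
  then have "eventually (\<lambda>\<epsilon>. norm (of_real \<epsilon> * d) < r) (at_right 0)"
    using \<open>r > 0\<close> by (auto elim!: order_tendstoD)
  then show "eventually (\<lambda>\<epsilon>. p + of_real \<epsilon> * d \<in> A) (at_right 0)"
    using eventually_at_right_less[of 0] by eventually_elim (use K \<open>d \<in> K\<close> in auto)
qed

text \<open>Both directions lie in one common sector. With equal directions this gives the existence
  of the region for every direction transversal to all strands through \<open>p\<close>.\<close>

lemma region_towards_cong:
  assumes "preimages P p" "finite P" "p \<in> range \<gamma>"
    and "\<And>s. s \<in> P \<Longrightarrow> wedge (\<gamma>' s) d1 * wedge (\<gamma>' s) d2 > 0"
  shows "region_towards D p d1 = region_towards D p d2" and "region_towards D p d1 \<in> regions D"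
  using sector_in_region[OF assms] region_towards_sector by metis+

text \<open>By continuity of the velocity, the derivative of
  \<open>wedge w (\<gamma> \<tau>)\<close> does not vanish near \<open>s\<close>, so by the mean
  value theorem this function is injective there. A chord parallel to \<open>w\<close> would have
  the same value at both ends.\<close>

lemma transversal_chord:
  assumes "wedge (\<gamma>' s) w \<noteq> 0"
  obtains \<delta> where "\<delta> > 0" "\<And>\<sigma> \<tau> \<theta>. \<bar>\<sigma> - s\<bar> < \<delta> \<Longrightarrow> \<bar>\<tau> - s\<bar> < \<delta> \<Longrightarrow> \<gamma> \<sigma> = \<gamma> \<tau> + of_real \<theta> * w \<Longrightarrow> \<theta> = 0"
proof -
  have "continuous_on UNIV (\<lambda>\<tau>. wedge w (\<gamma>' \<tau>))"
    by (intro continuous_intros continuous_velocity)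
  then have "((\<lambda>\<tau>. wedge w (\<gamma>' \<tau>)) \<longlongrightarrow> wedge w (\<gamma>' s)) (nhds s)"
    by (simp add: continuous_on_def tendsto_nhds_iff)
  moreover have "wedge w (\<gamma>' s) \<noteq> 0" using assms wedge_swap[of w "\<gamma>' s"] by simp
  ultimately have "eventually (\<lambda>\<tau>. wedge w (\<gamma>' \<tau>) \<noteq> 0) (nhds s)"
    by (rule tendsto_imp_eventually_ne)
  then obtain \<delta> where \<delta>: "\<delta> > 0" "\<And>\<tau>. \<bar>\<tau> - s\<bar> < \<delta> \<Longrightarrow> wedge w (\<gamma>' \<tau>) \<noteq> 0"
    by (auto simp: eventually_nhds_metric dist_real_def)
  have der: "((\<lambda>\<tau>. wedge w (\<gamma> \<tau>)) has_real_derivative wedge w (\<gamma>' \<tau>)) (at \<tau>)" for \<tau>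
    using bounded_linear.has_vector_derivative[OF bounded_linear_wedge has_velocity]
    by (simp add: has_real_derivative_iff_has_vector_derivative)
  have ne: "wedge w (\<gamma> x) \<noteq> wedge w (\<gamma> y)" if "x < y" "\<bar>x - s\<bar> < \<delta>" "\<bar>y - s\<bar> < \<delta>" for x y
  proof -
    obtain z where "z > x" "z < y" "wedge w (\<gamma> y) - wedge w (\<gamma> x) = (y - x) * wedge w (\<gamma>' z)"
      using MVT2[OF \<open>x < y\<close> der] by metis
    moreover have "wedge w (\<gamma>' z) \<noteq> 0" using \<delta>(2)[of z] that calculation by linarith
    ultimately show ?thesis using that by auto
  qed
  have "\<theta> = 0" if "\<bar>\<sigma> - s\<bar> < \<delta>" "\<bar>\<tau> - s\<bar> < \<delta>" "\<gamma> \<sigma> = \<gamma> \<tau> + of_real \<theta> * w" for \<sigma> \<tau> \<theta>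
  proof -
    have "wedge w (\<gamma> \<sigma>) = wedge w (\<gamma> \<tau>)"
      by (simp add: that(3) wedge_add_right wedge_scale_right wedge_self)
    then have "\<sigma> = \<tau>" using ne that by (metis linorder_neqE_linordered_idom)
    moreover have "w \<noteq> 0" using assms by (auto simp: wedge_def)
    ultimately show ?thesis using that by simp
  qed
  with \<delta>(1) show ?thesis using that by blast
qed

section \<open>Regular parameters and double points\<close>

definition regular :: "real \<Rightarrow> bool" where
  "regular t \<longleftrightarrow> \<gamma> t \<notin> (\<lambda>x. \<gamma> (fst x)) ` crossings D"

lemma finite_crossings: "finite (crossings D)"
  using diagram unfolding oriented_knot_diagram_def by blast

lemma crossingD:
  assumes "(s, t) \<in> crossings D"
  shows "s \<in> {0..<1}" "t \<in> {0..<1}" "s \<noteq> t" "\<gamma> s = \<gamma> t" "wedge (\<gamma>' s) (\<gamma>' t) \<noteq> 0"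
  using diagram assms unfolding oriented_knot_diagram_def wedge_def by blast+

lemma double_point_crossing:
  assumes "s \<in> {0..<1}" "t \<in> {0..<1}" "s \<noteq> t" "\<gamma> s = \<gamma> t"
  shows "((s, t) \<in> crossings D) \<noteq> ((t, s) \<in> crossings D)"
  using diagram assms unfolding oriented_knot_diagram_def by blast

lemma no_triple_points:
  assumes "r \<in> {0..<1}" "s \<in> {0..<1}" "t \<in> {0..<1}" "\<gamma> r = \<gamma> s" "\<gamma> s = \<gamma> t"
  shows "r = s \<or> s = t \<or> r = t"
  using diagram assms unfolding oriented_knot_diagram_def by blast

lemma curve_frac: "\<gamma> (frac t) = \<gamma> t"
  using curve_periodic[of t "- \<lfloor>t\<rfloor>"] by (simp add: frac_def)

lemma frac_in: "frac t \<in> {0..<1::real}"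
  by (simp add: frac_lt_1)

lemma crossing_preimages:
  assumes "(s, t) \<in> crossings D"
  shows "preimages {s, t} (\<gamma> s)"
  unfolding preimages_def
proof (intro conjI allI impI)
  fix \<sigma> assume "\<gamma> \<sigma> = \<gamma> s"
  then have "frac \<sigma> = s \<or> frac \<sigma> = t"
    using no_triple_points[of "frac \<sigma>" s t] crossingD[OF assms] frac_in curve_frac by metis
  then show "\<exists>k::int. \<sigma> - of_int k \<in> {s, t}"
    unfolding frac_def by blast
qed (use crossingD[OF assms] in auto)

text \<open>Two parameters over the same point that differ modulo 1 form a crossing, which cannot
  happen over a regular point.\<close>

lemma regular_preimages:
  assumes "regular t"
  shows "preimages {t} (\<gamma> t)"
  unfolding preimages_def
proof (intro conjI allI impI)
  fix \<sigma> assume eq: "\<gamma> \<sigma> = \<gamma> t"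
  have "frac \<sigma> = frac t"
  proof (rule ccontr)
    assume "frac \<sigma> \<noteq> frac t"
    then have "(frac \<sigma>, frac t) \<in> crossings D \<or> (frac t, frac \<sigma>) \<in> crossings D"
      using double_point_crossing[OF frac_in frac_in] eq by (metis curve_frac)
    then show False
      using assms eq unfolding regular_def by (force simp: curve_frac)
  qed
  then have "\<sigma> - of_int (\<lfloor>\<sigma>\<rfloor> - \<lfloor>t\<rfloor>) = t" by (simp add: frac_def)
  then show "\<exists>k::int. \<sigma> - of_int k \<in> {t}" by blast
qed auto

lemma open_regular: "open {t. regular t}"
proof -
  have "{t. regular t} = \<gamma> -` (- (\<lambda>x. \<gamma> (fst x)) ` crossings D)"
    by (auto simp: regular_def)
  then show ?thesis
    using finite_crossings
    by (auto intro!: open_vimage continuous_curve simp: open_Compl finite_imp_closed)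
qed

text \<open>There are finitely many crossing points. The curve stays away from those different from
  \<open>\<gamma> s\<close> by continuity and leaves \<open>\<gamma> s\<close> itself at once
  because its velocity is nonzero.\<close>

lemma eventually_regular: "eventually regular (at s)"
proof -
  have "eventually (\<lambda>\<tau>. \<gamma> \<tau> \<noteq> v) (at s)" for v
  proof (cases "v = \<gamma> s")
    case True
    have "norm (\<gamma>' s) / 2 > 0" using velocity_nonzero by simp
    from curve_linearization[OF this, of s] True velocity_nonzero[of s] show ?thesis
      by (auto simp: eventually_at_filter norm_mult of_real_diff[symmetric]
          simp del: of_real_diff elim!: eventually_mono)
  next
    case False
    have "(\<gamma> \<longlongrightarrow> \<gamma> s) (at s)"
      using continuous_curve[of UNIV] by (auto simp: continuous_on_def)
    then show ?thesis using False by (auto intro: tendsto_imp_eventually_ne)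
  qed
  then have "eventually (\<lambda>\<tau>. \<forall>v \<in> (\<lambda>x. \<gamma> (fst x)) ` crossings D. \<gamma> \<tau> \<noteq> v) (at s)"
    using finite_crossings by (intro eventually_ball_finite) auto
  then show ?thesis by (auto elim!: eventually_mono simp: regular_def)
qed

section \<open>The regions on the two sides of the curve\<close>

text \<open>Positive \<epsilon> stands for the left side of the oriented curve, negative \<epsilon>
  for the right side. A numerical \<epsilon> can be multiplied by the sign of a crossing.\<close>

definition side :: "real \<Rightarrow> real \<Rightarrow> complex set" where
  "side \<epsilon> t = region_towards D (\<gamma> t) (of_real \<epsilon> * (\<i> * \<gamma>' t))"

text \<open>Lets a fixed direction \<open>w\<close> replace the normal, which turns along the curve,
  as long as both point to the same side of the tangent.\<close>

lemma side_eq: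
  assumes "regular t" and "\<epsilon> * wedge (\<gamma>' t) w > 0"
  shows "region_towards D (\<gamma> t) w = side \<epsilon> t" and "side \<epsilon> t \<in> regions D"
proof -
  have "wedge (\<gamma>' t) w * wedge (\<gamma>' t) (of_real \<epsilon> * (\<i> * \<gamma>' t)) > 0"
    using assms(2) velocity_nonzero[of t]
    by (simp only: wedge_scale_right wedge_ii) (auto simp: zero_less_mult_iff mult_less_0_iff)
  then show "region_towards D (\<gamma> t) w = side \<epsilon> t" and "side \<epsilon> t \<in> regions D"
    using region_towards_cong[OF regular_preimages[OF assms(1)], of w "of_real \<epsilon> * (\<i> * \<gamma>' t)"]
    by (auto simp: side_def)
qed

lemma side_periodic: "side \<epsilon> (t + 1) = side \<epsilon> t"
  by (simp add: side_def curve_periodic_1 velocity_periodic)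

lemma normal_transversal:
  assumes "\<epsilon> \<noteq> 0"
  shows "\<epsilon> * wedge (\<gamma>' t) (of_real \<epsilon> * (\<i> * \<gamma>' t)) > 0"
  using assms velocity_nonzero[of t]
  by (simp only: wedge_scale_right wedge_ii) (auto simp: zero_less_mult_iff mult_less_0_iff)

lemma side_in_regions: "regular t \<Longrightarrow> \<epsilon> \<noteq> 0 \<Longrightarrow> side \<epsilon> t \<in> regions D"
  using side_eq(2) normal_transversal by blast

lemma sides_adjacent: "regular t \<Longrightarrow> adjacent D (side 1 t) (side (- 1) t)"
  unfolding adjacent_def regular_def side_def by (rule exI[of _ t]) simp

lemma eventually_transversal:
  assumes "\<epsilon> * wedge (\<gamma>' s) w > 0"
  shows "eventually (\<lambda>\<tau>. \<epsilon> * wedge (\<gamma>' \<tau>) w > 0) (nhds s)"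
proof -
  have "continuous_on UNIV (\<lambda>\<tau>. \<epsilon> * wedge (\<gamma>' \<tau>) w)"
    by (intro continuous_intros continuous_velocity)
  then have "((\<lambda>\<tau>. \<epsilon> * wedge (\<gamma>' \<tau>) w) \<longlongrightarrow> \<epsilon> * wedge (\<gamma>' s) w) (nhds s)"
    by (simp add: continuous_on_def tendsto_nhds_iff)
  then show ?thesis using assms by (rule order_tendstoD)
qed

text \<open>Pushing the arc near \<open>t\<close> off the diagram in a fixed transversal direction sweeps out a
  connected set.\<close>

lemma side_locally_constant:
  assumes "regular t" and "\<epsilon> \<noteq> 0"
  shows "eventually (\<lambda>\<tau>. side \<epsilon> \<tau> = side \<epsilon> t) (nhds t)"
proof -
  define w where "w = of_real \<epsilon> * (\<i> * \<gamma>' t)"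
  have w: "\<epsilon> * wedge (\<gamma>' t) w > 0"
    unfolding w_def using assms(2) by (rule normal_transversal)
  then have "wedge (\<gamma>' t) w \<noteq> 0" by auto
  then obtain \<delta> where \<delta>: "\<delta> > 0" "\<And>\<sigma> \<tau> \<theta>. \<bar>\<sigma> - t\<bar> < \<delta> \<Longrightarrow> \<bar>\<tau> - t\<bar> < \<delta> \<Longrightarrow>
      \<gamma> \<sigma> = \<gamma> \<tau> + of_real \<theta> * w \<Longrightarrow> \<theta> = 0"
    using transversal_chord by metis
  have "eventually (\<lambda>\<sigma>. \<bar>\<sigma> - t\<bar> < \<delta>) (nhds t)"
    using \<delta>(1) by (auto simp: eventually_nhds_metric dist_real_def)
  then have "eventually (\<lambda>\<sigma>. \<forall>\<tau> \<theta>. \<bar>\<tau> - t\<bar> < \<delta> \<and> \<theta> > 0 \<longrightarrow> \<gamma> \<sigma> \<noteq> \<gamma> \<tau> + of_real \<theta> * w) (nhds t)"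
    by eventually_elim (metis \<delta>(2) less_irrefl)
  \<comment> \<open>So far the pushed-off points avoid only the arc near \<open>t\<close>. Since no
    other strand runs through \<open>\<gamma> t\<close>, compactness extends this to all diagram
    points near \<open>\<gamma> t\<close>.\<close>
  then have "eventually (\<lambda>q. q \<in> range \<gamma> \<longrightarrow>
      (\<forall>\<tau> \<theta>. \<bar>\<tau> - t\<bar> < \<delta> \<and> \<theta> > 0 \<longrightarrow> q \<noteq> \<gamma> \<tau> + of_real \<theta> * w)) (nhds (\<gamma> t))"
    by (intro eventually_near_preimages[OF regular_preimages[OF assms(1)]]) simp
  then obtain r where r: "r > 0" "\<And>q \<tau> \<theta>. dist q (\<gamma> t) < r \<Longrightarrow> q \<in> range \<gamma> \<Longrightarrow>
      \<bar>\<tau> - t\<bar> < \<delta> \<Longrightarrow> \<theta> > 0 \<Longrightarrow> q \<noteq> \<gamma> \<tau> + of_real \<theta> * w"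
    unfolding eventually_nhds_metric by blast
  have "(\<gamma> \<longlongrightarrow> \<gamma> t) (nhds t)"
    using continuous_curve[of UNIV] by (simp add: continuous_on_def tendsto_nhds_iff)
  then have "eventually (\<lambda>\<tau>. dist (\<gamma> \<tau>) (\<gamma> t) < r / 2) (nhds t)"
    using r(1) by (intro tendstoD) auto
  then obtain \<delta>' where \<delta>': "\<delta>' > 0" "\<And>\<tau>. \<bar>\<tau> - t\<bar> < \<delta>' \<Longrightarrow> dist (\<gamma> \<tau>) (\<gamma> t) < r / 2"
    unfolding eventually_nhds_metric dist_real_def by blast
  \<comment> \<open>Half of the radius \<open>r\<close> is spent on moving along the arc, the other
    half on pushing off by at most \<open>\<rho> * norm w\<close>.\<close>
  define \<rho> where "\<rho> = r / (2 * (norm w + 1))"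
  have n: "norm w + 1 > 0" using norm_ge_zero[of w] by linarith
  then have "\<rho> > 0" using r(1) by (simp add: \<rho>_def)
  define d where "d = min \<delta> \<delta>'"
  have "d > 0" using \<delta>(1) \<delta>'(1) by (simp add: d_def)
  define T where "T = (\<lambda>x. \<gamma> (fst x) + of_real (snd x) * w) ` ({t - d<..<t + d} \<times> {0<..<\<rho>})"
  have "connected T"
    unfolding T_def
    by (intro connected_continuous_image continuous_intros continuous_on_compose2[OF continuous_curve]
        convex_connected convex_Times) auto
  moreover have "T \<noteq> {}"
    using \<open>d > 0\<close> \<open>\<rho> > 0\<close> by (auto simp: T_def)
  moreover have "T \<inter> range \<gamma> = {}"
  proof -
    have "\<gamma> \<tau> + of_real \<theta> * w \<notin> range \<gamma>" if "\<bar>\<tau> - t\<bar> < d" "0 < \<theta>" "\<theta> < \<rho>" for \<tau> \<theta>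
    proof
      assume a: "\<gamma> \<tau> + of_real \<theta> * w \<in> range \<gamma>"
      have "norm (of_real \<theta> * w) \<le> \<rho> * (norm w + 1)"
        using that by (auto simp: norm_mult intro!: mult_mono)
      also have "\<dots> = r / 2" using n by (simp add: \<rho>_def field_simps)
      finally have "dist (\<gamma> \<tau> + of_real \<theta> * w) (\<gamma> t) < r"
        using \<delta>'(2)[of \<tau>] that norm_triangle_ineq[of "\<gamma> \<tau> - \<gamma> t" "of_real \<theta> * w"]
        by (simp add: d_def dist_norm algebra_simps)
      then show False
        using r(2)[OF _ a, of \<tau> \<theta>] that by (simp add: d_def)
    qed
    moreover have "\<bar>\<tau> - t\<bar> < d" if "\<tau> \<in> {t - d<..<t + d}" for \<tau> using that by auto
    ultimately show ?thesis unfolding T_def by (force simp del: of_real_mult)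
  qed
  ultimately obtain A where A: "A \<in> regions D" "T \<subseteq> A"
    using connected_in_region by metis
  have toA: "region_towards D (\<gamma> \<tau>) w = A" if "\<bar>\<tau> - t\<bar> < d" for \<tau>
  proof (rule region_towards_eqI[OF A(1)])
    have "eventually (\<lambda>\<theta>. \<theta> \<in> {0<..<\<rho>}) (at_right 0)"
      using eventually_at_right_real[OF \<open>\<rho> > 0\<close>] .
    then show "eventually (\<lambda>\<theta>. \<gamma> \<tau> + of_real \<theta> * w \<in> A) (at_right 0)"
    proof eventually_elim
      case (elim \<theta>)
      then have "(\<tau>, \<theta>) \<in> {t - d<..<t + d} \<times> {0<..<\<rho>}" using that by auto
      then show ?case using A(2) unfolding T_def by force
    qed
  qed
  have "side \<epsilon> t = A"
    using side_eq(1)[OF assms(1) w] toA[of t] \<open>d > 0\<close> by simp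
  have "eventually (\<lambda>\<tau>. \<bar>\<tau> - t\<bar> < d) (nhds t)"
    using \<open>d > 0\<close> by (auto simp: eventually_nhds_metric dist_real_def)
  moreover have "eventually regular (nhds t)"
    using eventually_nhds_in_open[OF open_regular, of t] assms(1) by simp
  \<comment> \<open>For \<tau> near \<open>t\<close> the fixed direction \<open>w\<close> still
    points to the same side of the tangent, so \<open>A\<close> is the side at \<tau> as
    well.\<close>
  ultimately show ?thesis
    using eventually_transversal[OF w]
    by eventually_elim (use side_eq(1) toA \<open>side \<epsilon> t = A\<close> in metis)
qed

text \<open>Pushing the half-arc leaving a crossing along one strand off in the direction \<open>w\<close> of the
  other strand sweeps out a connected set that reaches the corner between the two.\<close>

lemma side_near_crossing:
  assumes P: "preimages {s, t} p" and trans: "wedge (\<gamma>' s) (\<gamma>' t) \<noteq> 0"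
    and \<sigma>: "\<sigma> = 1 \<or> \<sigma> = - 1" and w: "w = \<gamma>' t \<or> w = - \<gamma>' t"
    and \<epsilon>: "\<epsilon> * wedge (\<gamma>' s) w > 0"
  shows "eventually (\<lambda>h. side \<epsilon> (s + \<sigma> * h) = region_towards D p (of_real \<sigma> * \<gamma>' s + w)) (at_right 0)"
proof -
  define u v d where "u = \<gamma>' s" and "v = \<gamma>' t" and "d = of_real \<sigma> * u + w"
  have p: "\<gamma> s = p" "\<gamma> t = p" using P by (auto simp: preimages_def)
  have vw: "wedge v w = 0" using w by (auto simp: v_def wedge_minus_right wedge_self)
  have uw: "wedge u w \<noteq> 0" using \<epsilon> by (auto simp: u_def)
  have nw: "norm w = norm v" using w by (auto simp: v_def)
  have abs\<sigma>: "\<bar>\<sigma>\<bar> = 1" "\<sigma> \<noteq> 0" using \<sigma> by auto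
  define \<kappa> where "\<kappa> = \<bar>wedge v u\<bar>"
  have \<kappa>: "\<kappa> > 0" using trans wedge_swap[of u v] by (auto simp: \<kappa>_def u_def v_def)
  define M where "M = norm u + norm v + 1"
  have M: "M > 0" using norm_ge_zero[of u] norm_ge_zero[of v] unfolding M_def by linarith
  \<comment> \<open>The bound 1 gives \<open>norm_z\<close>; the other one keeps the error of
    \<open>wedge v\<close> within a quarter of its main term \<open>\<kappa> * h\<close>.\<close>
  define e where "e = min 1 (\<kappa> / (4 * (norm v + 1)))"
  have nv: "norm v + 1 > 0" using norm_ge_zero[of v] by linarith
  have e: "e > 0" "e \<le> 1" using \<kappa> nv by (auto simp: e_def)
  have ev: "norm v * e \<le> \<kappa> / 4"
  proof -
    have "norm v * e \<le> (norm v + 1) * (\<kappa> / (4 * (norm v + 1)))"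
      using e by (intro mult_mono) (auto simp: e_def)
    also have "\<dots> = \<kappa> / 4" using nv by (simp add: field_simps)
    finally show ?thesis .
  qed
  obtain \<delta>1 where \<delta>1: "\<delta>1 > 0" "\<And>\<sigma> \<tau> \<theta>. \<bar>\<sigma> - s\<bar> < \<delta>1 \<Longrightarrow> \<bar>\<tau> - s\<bar> < \<delta>1 \<Longrightarrow>
      \<gamma> \<sigma> = \<gamma> \<tau> + of_real \<theta> * w \<Longrightarrow> \<theta> = 0"
    using transversal_chord[of s w] uw unfolding u_def by metis
  have lin: "\<exists>\<delta>>0. \<forall>h. 0 < h \<and> h < \<delta> \<longrightarrow> norm (\<gamma> (s + \<sigma> * h) - p - of_real (\<sigma> * h) * u) \<le> e * h"
    if e: "e > 0" for e
  proof -
    obtain \<delta> where "\<delta> > 0" "\<And>\<tau>. \<bar>\<tau> - s\<bar> < \<delta> \<Longrightarrow> norm (\<gamma> \<tau> - p - of_real (\<tau> - s) * u) \<le> e * \<bar>\<tau> - s\<bar>"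
      using curve_linearization[OF e, of s] unfolding p eventually_nhds_metric dist_real_def u_def by blast
    note \<delta> = this
    have "norm (\<gamma> (s + \<sigma> * h) - p - of_real (\<sigma> * h) * u) \<le> e * h" if "0 < h" "h < \<delta>" for h
      using \<delta>(2)[of "s + \<sigma> * h"] that abs\<sigma> by (simp add: abs_mult)
    with \<delta>(1) show ?thesis by blast
  qed
  obtain \<delta>2 where \<delta>2: "\<delta>2 > 0" "\<And>h. 0 < h \<Longrightarrow> h < \<delta>2 \<Longrightarrow>
      norm (\<gamma> (s + \<sigma> * h) - p - of_real (\<sigma> * h) * u) \<le> e * h"
    using lin[OF e(1)] by blast
  define z where "z h \<theta> = \<gamma> (s + \<sigma> * h) + of_real \<theta> * w - p" for h \<theta>
  \<comment> \<open>Pushing off along \<open>w\<close> is parallel to \<open>v\<close> and does not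
    change \<open>wedge v\<close>. Together the two bounds keep the pushed-off points outside a cone
    around the tangent of the other strand.\<close>
  have norm_z: "norm (z h \<theta>) \<le> M * h" and wedge_z: "\<bar>wedge v (z h \<theta>)\<bar> \<ge> 3 * \<kappa> / 4 * h"
    if h: "0 < h" "h < \<delta>2" "0 < \<theta>" "\<theta> \<le> h" for h \<theta>
  proof -
    define y where "y = \<gamma> (s + \<sigma> * h) - p - of_real (\<sigma> * h) * u"
    have y: "norm y \<le> e * h" using \<delta>2(2)[OF h(1,2)] by (simp add: y_def)
    have z: "z h \<theta> = y + (of_real (\<sigma> * h) * u + of_real \<theta> * w)" by (simp add: z_def y_def)
    have "norm (z h \<theta>) \<le> norm y + norm (of_real (\<sigma> * h) * u) + norm (of_real \<theta> * w)"
      unfolding z by (smt (verit) norm_triangle_ineq)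
    also have "\<dots> \<le> h + h * norm u + h * norm v"
    proof (intro add_mono)
      show "norm y \<le> h" using y mult_right_mono[OF e(2), of h] h(1) by linarith
      show "norm (of_real \<theta> * w) \<le> h * norm v" using h nw by (simp add: norm_mult mult_right_mono)
    qed (use h abs\<sigma> in \<open>simp add: norm_mult abs_mult\<close>)
    finally show "norm (z h \<theta>) \<le> M * h" by (simp add: M_def algebra_simps)
    have "wedge v (z h \<theta>) = wedge v y + \<sigma> * h * wedge v u"
      unfolding z by (simp add: wedge_add_right wedge_scale_right vw del: of_real_mult)
    moreover have "\<bar>\<sigma> * h * wedge v u\<bar> = \<kappa> * h" using h abs\<sigma> by (simp add: abs_mult \<kappa>_def)
    moreover have "\<bar>wedge v y\<bar> \<le> \<kappa> / 4 * h"
    proof -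
      have "\<bar>wedge v y\<bar> \<le> norm v * (e * h)"
        using abs_wedge_le[of v y] mult_left_mono[OF y, of "norm v"] by simp
      also have "\<dots> \<le> \<kappa> / 4 * h" using mult_right_mono[OF ev, of h] h by (simp add: mult.assoc)
      finally show ?thesis .
    qed
    ultimately have "\<bar>wedge v (z h \<theta>)\<bar> \<ge> \<kappa> * h - \<kappa> / 4 * h" by linarith
    then show "\<bar>wedge v (z h \<theta>)\<bar> \<ge> 3 * \<kappa> / 4 * h" by simp
  qed
  define \<delta> where "\<delta> = min \<delta>1 \<delta>2"
  define Q where "Q q \<longleftrightarrow> (\<forall>h \<theta>. 0 < h \<and> h < \<delta> \<and> 0 < \<theta> \<and> \<theta> \<le> h \<longrightarrow> q \<noteq> p + z h \<theta>)" for q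
  have "eventually (\<lambda>q. q \<in> range \<gamma> \<longrightarrow> Q q) (nhds p)"
  proof (rule eventually_near_preimages[OF P])
    have "eventually (\<lambda>\<tau>. \<bar>\<tau> - s\<bar> < \<delta>1) (nhds s)"
      using \<delta>1(1) by (auto simp: eventually_nhds_metric dist_real_def)
    then have 1: "eventually (\<lambda>\<tau>. Q (\<gamma> \<tau>)) (nhds s)"
    proof eventually_elim
      case (elim \<tau>)
      have "\<theta> = 0" if "0 < h" "h < \<delta>" "\<gamma> \<tau> = p + z h \<theta>" for h \<theta>
        using \<delta>1(2)[OF elim, of "s + \<sigma> * h" \<theta>] that abs\<sigma>
        by (simp add: z_def \<delta>_def abs_mult)
      then show ?case unfolding Q_def by (metis less_irrefl)
    qed
    \<comment> \<open>With this cone width, a pushed-off point on the other strand would satisfy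
      \<open>\<bar>wedge v (z h \<theta>)\<bar> \<le> \<kappa> / 4 * h\<close>, contradicting
      \<open>wedge_z\<close>.\<close>
    have "\<kappa> / (4 * M) > 0" using \<kappa> M by simp
    from chord_nearly_tangent[OF this, of t]
    have 2: "eventually (\<lambda>\<tau>. Q (\<gamma> \<tau>)) (nhds t)"
    proof eventually_elim
      case (elim \<tau>)
      have False if h: "0 < h" "h < \<delta>" "0 < \<theta>" "\<theta> \<le> h" "\<gamma> \<tau> = p + z h \<theta>" for h \<theta>
      proof -
        have "3 * \<kappa> / 4 * h \<le> \<kappa> / (4 * M) * norm (z h \<theta>)"
          using elim wedge_z[of h \<theta>] h by (simp add: p v_def \<delta>_def)
        also have "\<dots> \<le> \<kappa> / (4 * M) * (M * h)"
          using norm_z[of h \<theta>] h \<kappa> M by (intro mult_left_mono) (auto simp: \<delta>_def)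
        also have "\<dots> = \<kappa> / 4 * h" using M by simp
        finally show False using \<kappa> h by (simp add: field_simps)
      qed
      then show ?case unfolding Q_def by blast
    qed
    show "eventually (\<lambda>\<tau>. Q (\<gamma> \<tau>)) (nhds a)" if "a \<in> {s, t}" for a
      using that 1 2 by auto
  qed
  then obtain r where r: "r > 0" "\<And>q. dist q p < r \<Longrightarrow> q \<in> range \<gamma> \<Longrightarrow> Q q"
    unfolding eventually_nhds_metric by blast
  define \<delta>' where "\<delta>' = min \<delta> (r / M)"
  have \<delta>': "\<delta>' > 0" using \<delta>1(1) \<delta>2(1) r(1) M by (simp add: \<delta>'_def \<delta>_def)
  \<comment> \<open>Writing \<theta> as \<open>l * h\<close> turns the triangle of admissible pairs
    into a rectangle. The value \<open>l = 1\<close> is included because it gives the points that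
    approach \<open>p\<close> in direction \<open>d\<close>.\<close>
  define T where "T = (\<lambda>x. \<gamma> (s + \<sigma> * fst x) + of_real (snd x * fst x) * w) ` ({0<..<\<delta>'} \<times> {0<..1})"
  have "connected T"
    unfolding T_def
    by (intro connected_continuous_image continuous_intros continuous_on_compose2[OF continuous_curve]
        convex_connected convex_Times) auto
  moreover have "T \<noteq> {}"
    using \<delta>' by (auto simp: T_def)
  moreover have "T \<inter> range \<gamma> = {}"
  proof -
    have "\<gamma> (s + \<sigma> * h) + of_real (l * h) * w \<notin> range \<gamma>"
      if h: "0 < h" "h < \<delta>'" "0 < l" "l \<le> 1" for h l
    proof
      assume a: "\<gamma> (s + \<sigma> * h) + of_real (l * h) * w \<in> range \<gamma>"
      have eq: "\<gamma> (s + \<sigma> * h) + of_real (l * h) * w = p + z h (l * h)" by (simp add: z_def)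
      have lh: "0 < l * h" "l * h \<le> h" using h by (auto simp: mult_left_le_one_le)
      have "norm (z h (l * h)) \<le> M * h" using norm_z h lh by (simp add: \<delta>'_def \<delta>_def)
      also have "\<dots> < r" using h M by (simp add: \<delta>'_def field_simps)
      finally have "Q (p + z h (l * h))" using r(2) a unfolding eq by (simp add: dist_norm)
      moreover have "h < \<delta>" using h by (simp add: \<delta>'_def)
      ultimately show False using h(1) lh unfolding Q_def by blast
    qed
    then show ?thesis unfolding T_def by (auto simp del: of_real_mult) (metis rangeI)
  qed
  ultimately obtain A where A: "A \<in> regions D" "T \<subseteq> A"
    using connected_in_region by metis
  have inA: "\<gamma> (s + \<sigma> * h) + of_real (l * h) * w \<in> A" if "0 < h" "h < \<delta>'" "0 < l" "l \<le> 1" for h l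
  proof -
    have "(h, l) \<in> {0<..<\<delta>'} \<times> {0<..1}" using that by auto
    then show ?thesis using A(2) unfolding T_def by force
  qed
  have toA: "region_towards D (\<gamma> (s + \<sigma> * h)) w = A" if h: "0 < h" "h < \<delta>'" for h
  proof (rule region_towards_eqI[OF A(1)])
    have "eventually (\<lambda>\<theta>. \<theta> \<in> {0<..<h}) (at_right 0)"
      using eventually_at_right_real[OF h(1)] .
    then show "eventually (\<lambda>\<theta>. \<gamma> (s + \<sigma> * h) + of_real \<theta> * w \<in> A) (at_right 0)"
    proof eventually_elim
      case (elim \<theta>)
      then show ?case using inA[OF h, of "\<theta> / h"] h by simp
    qed
  qed
  have pr: "p \<in> range \<gamma>" using p by blast
  \<comment> \<open>The direction \<open>d\<close> is tangent to neither strand, so the sector lemma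
    applies with \<open>d\<close> in both places.\<close>
  have "wedge (\<gamma>' a) d * wedge (\<gamma>' a) d > 0" if "a \<in> {s, t}" for a
  proof -
    have "wedge u d = wedge u w" "wedge v d = \<sigma> * wedge v u"
      unfolding d_def by (simp_all add: wedge_add_right wedge_scale_right wedge_self vw)
    then have "wedge (\<gamma>' a) d \<noteq> 0"
      using that uw \<kappa> abs\<sigma> by (auto simp: u_def v_def \<kappa>_def)
    then show ?thesis by (simp add: zero_less_mult_iff linorder_neq_iff) linarith
  qed
  from sector_in_region[OF P _ pr this] obtain B K r2 where B: "B \<in> regions D" "open K" "d \<in> K" "r2 > 0"
    "\<And>z \<epsilon>. z \<in> K \<Longrightarrow> \<epsilon> > 0 \<Longrightarrow> norm (of_real \<epsilon> * z) < r2 \<Longrightarrow> p + of_real \<epsilon> * z \<in> B"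
    by auto
  have toB: "region_towards D p d = B"
    using B by (rule region_towards_sector)
  \<comment> \<open>The rescaled direction from \<open>p\<close> to the point of \<open>T\<close>
    with \<open>l = 1\<close>. It tends to \<open>d\<close>, so it enters the open cone
    \<open>K\<close>; that point then lies in both \<open>A\<close> and \<open>B\<close>.\<close>
  define k where "k h = (\<gamma> (s + \<sigma> * h) - p) / of_real h + w" for h
  have k: "(k \<longlongrightarrow> d) (at_right 0)"
  proof (rule tendstoI)
    fix e :: real assume "e > 0"
    then obtain \<delta> where \<delta>: "\<delta> > 0" "\<And>h. 0 < h \<Longrightarrow> h < \<delta> \<Longrightarrow>
        norm (\<gamma> (s + \<sigma> * h) - p - of_real (\<sigma> * h) * u) \<le> e / 2 * h"
      using lin[of "e / 2"] by auto
    show "eventually (\<lambda>h. dist (k h) d < e) (at_right 0)"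
      using eventually_at_right_real[OF \<delta>(1)]
    proof eventually_elim
      case (elim h)
      then have "k h - d = (\<gamma> (s + \<sigma> * h) - p - of_real (\<sigma> * h) * u) / of_real h"
        by (simp add: k_def d_def diff_divide_distrib)
      then have "norm (k h - d) = norm (\<gamma> (s + \<sigma> * h) - p - of_real (\<sigma> * h) * u) / h"
        using elim by (simp add: norm_divide)
      also have "\<dots> \<le> e / 2" using \<delta>(2)[of h] elim by (simp add: field_simps)
      finally show ?case using \<open>e > 0\<close> by (simp add: dist_norm)
    qed
  qed
  have "((\<lambda>h. norm (of_real h * k h)) \<longlongrightarrow> norm (of_real 0 * d)) (at_right 0)"
    by (intro tendsto_intros k)
  then have "eventually (\<lambda>h. norm (of_real h * k h) < r2) (at_right 0)"
    using B(4) by (auto elim!: order_tendstoD)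
  moreover have "eventually (\<lambda>h. k h \<in> K) (at_right 0)"
    using topological_tendstoD[OF k B(2,3)] .
  moreover have "eventually (\<lambda>h. h \<in> {0<..<\<delta>'}) (at_right 0)"
    using eventually_at_right_real[OF \<delta>'] .
  ultimately have "eventually (\<lambda>h. norm (of_real h * k h) < r2 \<and> k h \<in> K \<and> h \<in> {0<..<\<delta>'}) (at_right 0)"
    by eventually_elim auto
  then obtain h where h: "norm (of_real h * k h) < r2" "k h \<in> K" "0 < h" "h < \<delta>'"
    by (metis (no_types, lifting) eventually_happens' trivial_limit_at_right_real greaterThanLessThan_iff)
  have "p + of_real h * k h \<in> B" using B(5) h by blast
  moreover have "p + of_real h * k h = \<gamma> (s + \<sigma> * h) + of_real (1 * h) * w"
    using h(3) by (simp add: k_def distrib_left)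
  then have "p + of_real h * k h \<in> A" using inA[of h 1] h by simp
  ultimately have "A = B"
    using A(1) B(1) unfolding regions_def by (metis IntI components_eq empty_iff)
  have lim: "filterlim (\<lambda>h. s + \<sigma> * h) (at s) (at_right 0)"
  proof (rule filterlim_atI)
    have "((\<lambda>h. s + \<sigma> * h) \<longlongrightarrow> s + \<sigma> * 0) (at_right 0)" by (intro tendsto_intros)
    then show "((\<lambda>h. s + \<sigma> * h) \<longlongrightarrow> s) (at_right 0)" by simp
    show "eventually (\<lambda>h. s + \<sigma> * h \<noteq> s) (at_right 0)"
      using eventually_at_right_less[of 0] by eventually_elim (use abs\<sigma> in auto)
  qed
  have "eventually (\<lambda>\<tau>. regular \<tau> \<and> \<epsilon> * wedge (\<gamma>' \<tau>) w > 0) (at s)"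
    using eventually_regular[of s] eventually_transversal[OF \<epsilon>]
    by (auto simp: eventually_at_filter elim: eventually_elim2)
  from eventually_compose_filterlim[OF this lim] eventually_at_right_real[OF \<delta>']
  show "eventually (\<lambda>h. side \<epsilon> (s + \<sigma> * h) = region_towards D p (of_real \<sigma> * \<gamma>' s + w)) (at_right 0)"
  proof eventually_elim
    case (elim h)
    then have "side \<epsilon> (s + \<sigma> * h) = A" using side_eq(1)[of "s + \<sigma> * h" \<epsilon> w] toA[of h] by auto
    then show ?case using toB \<open>A = B\<close> by (simp add: d_def u_def)
  qed
qed

section \<open>Quadrants at a crossing\<close>

text \<open>The usual sign of an oriented crossing.\<close>

definition orient :: "real \<times> real \<Rightarrow> real" where
  "orient x = sgn (wedge (\<gamma>' (fst x)) (\<gamma>' (snd x)))"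

text \<open>Indexing the corners by two signs, the first for the over-strand and the second for the
  under-strand, treats all half-arcs at a crossing uniformly.\<close>

definition quadrant :: "real \<times> real \<Rightarrow> real \<Rightarrow> real \<Rightarrow> complex set" where
  "quadrant x \<sigma> \<tau> = region_towards D (\<gamma> (fst x)) (of_real \<sigma> * \<gamma>' (fst x) + of_real \<tau> * \<gamma>' (snd x))"

lemma corner_quadrant:
  "corner D x (over_dir D x + under_dir D x) = quadrant x 1 1"
  "corner D x (over_dir D x - under_dir D x) = quadrant x 1 (- 1)"
  "corner D x (- over_dir D x - under_dir D x) = quadrant x (- 1) (- 1)"
  "corner D x (- over_dir D x + under_dir D x) = quadrant x (- 1) 1"
  by (simp_all add: corner_def quadrant_def over_dir_def under_dir_def)

lemma orient_cases: "x \<in> crossings D \<Longrightarrow> orient x = 1 \<or> orient x = - 1"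
  using crossingD(5)[of "fst x" "snd x"] by (auto simp: orient_def sgn_if)

text \<open>\<open>side_near_crossing\<close> applied to each strand, with the other one as pushing
  direction. Exchanging the strands reverses the sign of \<open>wedge\<close>, hence the minus sign
  for the under-strand.\<close>

lemma
  assumes x: "x \<in> crossings D" and \<sigma>: "\<sigma> = 1 \<or> \<sigma> = - 1" and \<tau>: "\<tau> = 1 \<or> \<tau> = - 1"
  shows side_over: "eventually (\<lambda>h. side (\<tau> * orient x) (fst x + \<sigma> * h) = quadrant x \<sigma> \<tau>) (at_right 0)"
    and side_under: "eventually (\<lambda>h. side (- \<tau> * orient x) (snd x + \<sigma> * h) = quadrant x \<tau> \<sigma>) (at_right 0)"
proof -
  obtain s t where st: "x = (s, t)" by force
  note c = crossingD[OF x[unfolded st]]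
  have P: "preimages {s, t} (\<gamma> s)" "preimages {t, s} (\<gamma> s)"
    using crossing_preimages[OF x[unfolded st]] by (simp_all add: insert_commute)
  have ne: "wedge (\<gamma>' t) (\<gamma>' s) \<noteq> 0" using c(5) wedge_swap[of "\<gamma>' t" "\<gamma>' s"] by simp
  have pos: "orient x * wedge (\<gamma>' s) (\<gamma>' t) > 0"
    using c(5) by (auto simp: orient_def st sgn_if)
  have sq: "\<tau> * \<tau> = 1" using \<tau> by auto
  have w: "of_real \<tau> * \<gamma>' t = \<gamma>' t \<or> of_real \<tau> * \<gamma>' t = - \<gamma>' t"
    "of_real \<tau> * \<gamma>' s = \<gamma>' s \<or> of_real \<tau> * \<gamma>' s = - \<gamma>' s"
    using \<tau> by auto
  have "(\<tau> * orient x) * wedge (\<gamma>' s) (of_real \<tau> * \<gamma>' t) = (\<tau> * \<tau>) * (orient x * wedge (\<gamma>' s) (\<gamma>' t))"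
    by (simp only: wedge_scale_right) simp
  then have 1: "(\<tau> * orient x) * wedge (\<gamma>' s) (of_real \<tau> * \<gamma>' t) > 0"
    using pos unfolding sq mult_1 by metis
  have "(- \<tau> * orient x) * wedge (\<gamma>' t) (of_real \<tau> * \<gamma>' s) = (\<tau> * \<tau>) * (orient x * wedge (\<gamma>' s) (\<gamma>' t))"
    by (simp only: wedge_scale_right wedge_swap[of "\<gamma>' t"]) simp
  then have 2: "(- \<tau> * orient x) * wedge (\<gamma>' t) (of_real \<tau> * \<gamma>' s) > 0"
    using pos unfolding sq mult_1 by metis
  show "eventually (\<lambda>h. side (\<tau> * orient x) (fst x + \<sigma> * h) = quadrant x \<sigma> \<tau>) (at_right 0)"
    using side_near_crossing[OF P(1) c(5) \<sigma> w(1) 1] by (simp_all add: quadrant_def st)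
  show "eventually (\<lambda>h. side (- \<tau> * orient x) (snd x + \<sigma> * h) = quadrant x \<tau> \<sigma>) (at_right 0)"
    using side_near_crossing[OF P(2) ne \<sigma> w(2) 2] by (simp add: quadrant_def st add.commute)
qed

lemma
  assumes x: "x \<in> crossings D" and \<sigma>: "\<sigma> = 1 \<or> \<sigma> = - 1"
  shows sides_over: "eventually (\<lambda>h. side (orient x) (fst x + \<sigma> * h) = quadrant x \<sigma> 1) (at_right 0)"
      "eventually (\<lambda>h. side (- orient x) (fst x + \<sigma> * h) = quadrant x \<sigma> (- 1)) (at_right 0)"
    and sides_under: "eventually (\<lambda>h. side (- orient x) (snd x + \<sigma> * h) = quadrant x 1 \<sigma>) (at_right 0)"
      "eventually (\<lambda>h. side (orient x) (snd x + \<sigma> * h) = quadrant x (- 1) \<sigma>) (at_right 0)"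
  using side_over[OF x \<sigma>, of 1] side_over[OF x \<sigma>, of "- 1"]
    side_under[OF x \<sigma>, of 1] side_under[OF x \<sigma>, of "- 1"]
  by simp_all

lemma eventually_regular_shift:
  assumes "\<sigma> = 1 \<or> \<sigma> = - 1"
  shows "eventually (\<lambda>h. regular (s + \<sigma> * h)) (at_right 0)"
  using eventually_regular[of s] assms
  unfolding eventually_at_split eventually_at_right_shift[of _ s] eventually_at_left_shift[of _ s] by auto


section \<open>Colors and indices at a crossing\<close>

lemma sides_differ:
  assumes S: "checkerboard_coloring D S" and "regular t" and \<epsilon>: "\<epsilon> = 1 \<or> \<epsilon> = - 1"
  shows "(side \<epsilon> t \<in> S) \<noteq> (side (- \<epsilon>) t \<in> S)"
proof -
  have "(side 1 t \<in> S) \<noteq> (side (- 1) t \<in> S)"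
    using S sides_adjacent[OF assms(2)] side_in_regions[OF assms(2)]
    unfolding checkerboard_coloring_def by auto
  then show ?thesis using \<epsilon> by auto
qed

text \<open>The two quadrants are the two sides of a half-arc at the crossing, and this half-arc
  contains regular parameters, at which the sides have different colors.\<close>

lemma quadrant_colors:
  assumes S: "checkerboard_coloring D S" and x: "x \<in> crossings D"
    and \<sigma>: "\<sigma> = 1 \<or> \<sigma> = - 1"
  shows "(quadrant x \<sigma> 1 \<in> S) \<noteq> (quadrant x \<sigma> (- 1) \<in> S)"
    and "(quadrant x 1 \<sigma> \<in> S) \<noteq> (quadrant x (- 1) \<sigma> \<in> S)"
proof -
  note over = sides_over[OF x \<sigma>] and under = sides_under[OF x \<sigma>] and e = orient_cases[OF x]
  have "eventually (\<lambda>h. (quadrant x \<sigma> 1 \<in> S) \<noteq> (quadrant x \<sigma> (- 1) \<in> S)) (at_right (0::real))"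
    using over(1) over(2) eventually_regular_shift[OF \<sigma>, of "fst x"]
    by eventually_elim (metis sides_differ[OF S _ e])
  then show "(quadrant x \<sigma> 1 \<in> S) \<noteq> (quadrant x \<sigma> (- 1) \<in> S)" by simp
  have "eventually (\<lambda>h. (quadrant x 1 \<sigma> \<in> S) \<noteq> (quadrant x (- 1) \<sigma> \<in> S)) (at_right (0::real))"
    using under(1) under(2) eventually_regular_shift[OF \<sigma>, of "snd x"]
    by eventually_elim (metis sides_differ[OF S _ e])
  then show "(quadrant x 1 \<sigma> \<in> S) \<noteq> (quadrant x (- 1) \<sigma> \<in> S)" by simp
qed

lemma quadrant_shaded_iff:
  assumes S: "checkerboard_coloring D S" and x: "x \<in> crossings D"
  shows "quadrant x 1 (- 1) \<in> S \<longleftrightarrow> quadrant x 1 1 \<notin> S"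
    and "quadrant x (- 1) 1 \<in> S \<longleftrightarrow> quadrant x 1 1 \<notin> S"
    and "quadrant x (- 1) (- 1) \<in> S \<longleftrightarrow> quadrant x 1 1 \<in> S"
  using quadrant_colors[OF S x, of 1] quadrant_colors[OF S x, of "- 1"] by auto

lemma dehn_coeff_quadrant:
  "dehn_coeff D x A = of_bool (quadrant x 1 1 = A) + of_bool (quadrant x 1 (- 1) = A)
     - of_bool (quadrant x (- 1) (- 1) = A) - of_bool (quadrant x (- 1) 1 = A)"
  by (simp only: dehn_coeff_def Let_def corner_quadrant)

lemma corner_regions_quadrant:
  "corner_regions D x = {quadrant x 1 1, quadrant x 1 (- 1), quadrant x (- 1) (- 1), quadrant x (- 1) 1}"
  by (simp only: corner_regions_def Let_def image_insert image_empty corner_quadrant)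

lemma goeritz_index_cases: "goeritz_index D S x = 1 \<or> goeritz_index D S x = - 1"
  by (simp add: goeritz_index_def)

text \<open>The rotation sweeps over the quadrants with equal signs if \<open>orient x = 1\<close>
  and over the other two if \<open>orient x = - 1\<close>. Opposite quadrants have the same color,
  so the color of one quadrant decides.\<close>

lemma goeritz_index_quadrant:
  assumes S: "checkerboard_coloring D S" and x: "x \<in> crossings D"
  shows "real_of_int (goeritz_index D S x) = (if quadrant x 1 1 \<in> S then orient x else - orient x)"
proof (cases "orient x = 1")
  case True
  then have "swept_regions D x = {quadrant x 1 1, quadrant x (- 1) (- 1)}"
    unfolding swept_regions_def Let_def corner_quadrant[symmetric]
    by (auto simp: orient_def wedge_def over_dir_def under_dir_def sgn_if split: if_splits)
  then show ?thesis
    using True quadrant_shaded_iff[OF S x]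
    by (auto simp: goeritz_index_def)
next
  case False
  then have "orient x = - 1" using orient_cases[OF x] by blast
  moreover from this have "swept_regions D x = {quadrant x 1 (- 1), quadrant x (- 1) 1}"
    unfolding swept_regions_def Let_def corner_quadrant[symmetric]
    by (auto simp: orient_def wedge_def over_dir_def under_dir_def sgn_if split: if_splits)
  ultimately show ?thesis
    using quadrant_shaded_iff[OF S x]
    by (auto simp: goeritz_index_def)
qed

text \<open>Corners of the wrong color cannot be \<open>B\<close>. This leaves two opposite corners,
  which enter the Dehn equation with opposite signs.\<close>

lemma shaded_corner:
  assumes S: "checkerboard_coloring D S" and x: "x \<in> crossings D" and B: "B \<in> S"
  shows "dehn_coeff D x B = (if quadrant x 1 1 \<in> S
      then of_bool (quadrant x 1 1 = B) - of_bool (quadrant x (- 1) (- 1) = B)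
      else of_bool (quadrant x 1 (- 1) = B) - of_bool (quadrant x (- 1) 1 = B))"
    and "B \<in> corner_regions D x \<longleftrightarrow> (if quadrant x 1 1 \<in> S
      then quadrant x 1 1 = B \<or> quadrant x (- 1) (- 1) = B
      else quadrant x 1 (- 1) = B \<or> quadrant x (- 1) 1 = B)"
proof -
  have "quadrant x 1 (- 1) \<noteq> B \<and> quadrant x (- 1) 1 \<noteq> B" if "quadrant x 1 1 \<in> S"
    using that B quadrant_shaded_iff[OF S x] by metis
  moreover have "quadrant x 1 1 \<noteq> B \<and> quadrant x (- 1) (- 1) \<noteq> B" if "quadrant x 1 1 \<notin> S"
    using that B quadrant_shaded_iff[OF S x] by metis
  ultimately show "dehn_coeff D x B = (if quadrant x 1 1 \<in> S
      then of_bool (quadrant x 1 1 = B) - of_bool (quadrant x (- 1) (- 1) = B)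
      else of_bool (quadrant x 1 (- 1) = B) - of_bool (quadrant x (- 1) 1 = B))"
    and "B \<in> corner_regions D x \<longleftrightarrow> (if quadrant x 1 1 \<in> S
      then quadrant x 1 1 = B \<or> quadrant x (- 1) (- 1) = B
      else quadrant x 1 (- 1) = B \<or> quadrant x (- 1) 1 = B)"
    by (auto simp: dehn_coeff_quadrant corner_regions_quadrant)
qed

text \<open>If two different shaded regions meet at \<open>x\<close>, each fills one of the two
  shaded corners, whence the product -1. In the sum over \<open>S\<close> the contributions 1 and -1
  of these corners cancel, even if one region fills both.\<close>

lemma dehn_coeff_shaded:
  assumes S: "checkerboard_coloring D S" and x: "x \<in> crossings D"
  shows "B \<in> S \<Longrightarrow> dehn_coeff D x B \<in> {- 1, 0, 1}"
    and "B \<in> S \<Longrightarrow> C \<in> S \<Longrightarrow> B \<noteq> C \<Longrightarrow> dehn_coeff D x B * dehn_coeff D x C =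
      - of_bool (B \<in> corner_regions D x \<and> C \<in> corner_regions D x)"
    and "finite S \<Longrightarrow> (\<Sum>C\<in>S. dehn_coeff D x C) = 0"
proof -
  show "B \<in> S \<Longrightarrow> dehn_coeff D x B \<in> {- 1, 0, 1}"
    by (auto simp: shaded_corner(1)[OF S x])
  show "B \<in> S \<Longrightarrow> C \<in> S \<Longrightarrow> B \<noteq> C \<Longrightarrow> dehn_coeff D x B * dehn_coeff D x C =
      - of_bool (B \<in> corner_regions D x \<and> C \<in> corner_regions D x)"
    by (simp add: shaded_corner[OF S x]) auto
  have "(\<Sum>C\<in>S. of_bool (A = C)) = (of_bool (A \<in> S) :: int)" if "finite S" for A
    using that by (simp add: of_bool_def)
  then show "finite S \<Longrightarrow> (\<Sum>C\<in>S. dehn_coeff D x C) = 0"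
    using quadrant_shaded_iff[OF S x] by (simp add: dehn_coeff_quadrant sum.distrib sum_subtractf)
qed


section \<open>Vanishing of the unshaded columns\<close>

text \<open>Measures the signed incidence of the curve with the arcs separating \<open>B\<close> from \<open>C\<close>.\<close>

definition border :: "complex set \<Rightarrow> complex set \<Rightarrow> complex set \<Rightarrow> complex set \<Rightarrow> real" where
  "border B C L R = of_bool (L = B) * of_bool (R = C) - of_bool (L = C) * of_bool (R = B)"

definition border_at :: "complex set \<Rightarrow> complex set \<Rightarrow> real \<Rightarrow> real" where
  "border_at B C t = border B C (side 1 t) (side (- 1) t)"

lemma border_swap: "border B C R L = - border B C L R"
  by (simp add: border_def)

lemma border_at_orient:
  assumes "e = 1 \<or> e = - 1"
  shows "border_at B C t = e * border B C (side e t) (side (- e) t)"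
  using assms by (auto simp: border_at_def border_swap[of B C "side 1 t"])

text \<open>The side \<open>orient x\<close> of the over-strand consists of the quadrants with
  second sign 1, that of the under-strand of the quadrants with first sign -1.\<close>

lemma border_limits:
  assumes x: "x \<in> crossings D"
  shows "eventually (\<lambda>t. border_at B C t = orient x * border B C (quadrant x 1 1) (quadrant x 1 (- 1))) (at_right (fst x))"
    and "eventually (\<lambda>t. border_at B C t = orient x * border B C (quadrant x (- 1) 1) (quadrant x (- 1) (- 1))) (at_left (fst x))"
    and "eventually (\<lambda>t. border_at B C t = orient x * border B C (quadrant x (- 1) 1) (quadrant x 1 1)) (at_right (snd x))"
    and "eventually (\<lambda>t. border_at B C t = orient x * border B C (quadrant x (- 1) (- 1)) (quadrant x 1 (- 1))) (at_left (snd x))"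
proof -
  have over: "eventually (\<lambda>h. border_at B C (fst x + \<sigma> * h) =
      orient x * border B C (quadrant x \<sigma> 1) (quadrant x \<sigma> (- 1))) (at_right 0)"
    if \<sigma>: "\<sigma> = 1 \<or> \<sigma> = - 1" for \<sigma>
    using sides_over[OF x \<sigma>]
    by eventually_elim (simp add: border_at_orient[OF orient_cases[OF x]])
  have under: "eventually (\<lambda>h. border_at B C (snd x + \<sigma> * h) =
      orient x * border B C (quadrant x (- 1) \<sigma>) (quadrant x 1 \<sigma>)) (at_right 0)"
    if \<sigma>: "\<sigma> = 1 \<or> \<sigma> = - 1" for \<sigma>
    using sides_under[OF x \<sigma>]
    by eventually_elim (simp add: border_at_orient[OF orient_cases[OF x]])
  show "eventually (\<lambda>t. border_at B C t = orient x * border B C (quadrant x 1 1) (quadrant x 1 (- 1))) (at_right (fst x))"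
    and "eventually (\<lambda>t. border_at B C t = orient x * border B C (quadrant x (- 1) 1) (quadrant x (- 1) (- 1))) (at_left (fst x))"
    and "eventually (\<lambda>t. border_at B C t = orient x * border B C (quadrant x (- 1) 1) (quadrant x 1 1)) (at_right (snd x))"
    and "eventually (\<lambda>t. border_at B C t = orient x * border B C (quadrant x (- 1) (- 1)) (quadrant x 1 (- 1))) (at_left (snd x))"
    unfolding eventually_at_right_shift[of _ "fst x"] eventually_at_left_shift[of _ "fst x"]
      eventually_at_right_shift[of _ "snd x"] eventually_at_left_shift[of _ "snd x"]
    using over[of 1] over[of "- 1"] under[of 1] under[of "- 1"] by simp_all
qed

lemma border_periodic: "border_at B C (t + 1) = border_at B C t"
  by (simp add: border_at_def side_periodic)

lemma border_locally_constant:
  assumes "regular t"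
  shows "eventually (\<lambda>\<tau>. border_at B C \<tau> = border_at B C t) (nhds t)"
  using side_locally_constant[OF assms, of 1, simplified]
    side_locally_constant[OF assms, of "- 1", simplified]
  by eventually_elim (simp add: border_at_def)

text \<open>Each Dehn coefficient is a difference of two indicators, one for each corner of the
  matching color. Each of the four half-arcs separates a shaded from an unshaded corner and yields
  one of the four terms of the expanded product. Exchanging the colors reverses both
  \<open>border\<close> and the Goeritz index.\<close>

lemma jump_at_crossing:
  assumes S: "checkerboard_coloring D S" and x: "x \<in> crossings D" and "B \<in> S" and "C \<notin> S"
  shows "orient x * border B C (quadrant x 1 1) (quadrant x 1 (- 1))
       - orient x * border B C (quadrant x (- 1) 1) (quadrant x (- 1) (- 1))
       + (orient x * border B C (quadrant x (- 1) 1) (quadrant x 1 1)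
       - orient x * border B C (quadrant x (- 1) (- 1)) (quadrant x 1 (- 1)))
     = real_of_int (goeritz_index D S x * dehn_coeff D x B * dehn_coeff D x C)"
proof -
  note q = quadrant_shaded_iff[OF S x]
  show ?thesis
  proof (cases "quadrant x 1 1 \<in> S")
    case True
    with q have "quadrant x 1 (- 1) \<noteq> B" "quadrant x (- 1) 1 \<noteq> B"
      "quadrant x 1 1 \<noteq> C" "quadrant x (- 1) (- 1) \<noteq> C"
      using assms by auto
    then show ?thesis
      using True by (simp add: goeritz_index_quadrant[OF S x] border_def dehn_coeff_quadrant algebra_simps)
  next
    case False
    with q have "quadrant x 1 (- 1) \<noteq> C" "quadrant x (- 1) 1 \<noteq> C"
      "quadrant x 1 1 \<noteq> B" "quadrant x (- 1) (- 1) \<noteq> B"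
      using assms by auto
    then show ?thesis
      using False by (simp add: goeritz_index_quadrant[OF S x] border_def dehn_coeff_quadrant algebra_simps)
  qed
qed

section \<open>Summation of the jumps over one period\<close>

definition crossing_params :: "real set" where
  "crossing_params = fst ` crossings D \<union> snd ` crossings D"

text \<open>Every parameter in the set belongs to one crossing and plays one role there: without
  triple points its partner is unique, and a pair is not a crossing in both orders.\<close>

lemma sum_crossing_params:
  fixes g :: "real \<Rightarrow> 'b :: ab_group_add"
  shows "(\<Sum>t\<in>crossing_params. g t) = (\<Sum>x\<in>crossings D. g (fst x) + g (snd x))"
proof -
  have once: "a = b"
    if x: "(a, c) \<in> crossings D \<or> (c, a) \<in> crossings D"
      and y: "(b, c) \<in> crossings D \<or> (c, b) \<in> crossings D" for a b c
  proof -
    have "a \<in> {0..<1} \<and> c \<in> {0..<1} \<and> a \<noteq> c \<and> \<gamma> a = \<gamma> c" using x crossingD by metis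
    moreover have "b \<in> {0..<1} \<and> b \<noteq> c \<and> \<gamma> c = \<gamma> b" using y crossingD by metis
    ultimately show ?thesis using no_triple_points[of a c b] by blast
  qed
  have "inj_on fst (crossings D)" by (auto intro!: inj_onI; metis once)
  moreover have "inj_on snd (crossings D)" by (auto intro!: inj_onI; metis once)
  moreover have "fst ` crossings D \<inter> snd ` crossings D = {}"
  proof -
    have False if "(c, a) \<in> crossings D" "(b, c) \<in> crossings D" for a b c
    proof -
      have "a = b" using once that by blast
      then show False using that double_point_crossing[OF crossingD(1-4)[OF that(1)]] by blast
    qed
    then show ?thesis by fastforce
  qed
  ultimately show ?thesis
    using finite_crossings
    by (simp add: crossing_params_def sum.union_disjoint sum.reindex sum.distrib)
qed

lemma sum_jumps_crossings:
  assumes F: "\<And>t. F (t + 1) = (F t :: real)"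
    and const: "\<And>t. regular t \<Longrightarrow> eventually (\<lambda>\<tau>. F \<tau> = F t) (nhds t)"
    and lim: "\<And>x. x \<in> crossings D \<Longrightarrow> eventually (\<lambda>\<tau>. F \<tau> = R1 x) (at_right (fst x))"
      "\<And>x. x \<in> crossings D \<Longrightarrow> eventually (\<lambda>\<tau>. F \<tau> = L1 x) (at_left (fst x))"
      "\<And>x. x \<in> crossings D \<Longrightarrow> eventually (\<lambda>\<tau>. F \<tau> = R2 x) (at_right (snd x))"
      "\<And>x. x \<in> crossings D \<Longrightarrow> eventually (\<lambda>\<tau>. F \<tau> = L2 x) (at_left (snd x))"
  shows "(\<Sum>x\<in>crossings D. R1 x - L1 x + (R2 x - L2 x)) = 0"
proof -
  \<comment> \<open>The given limits are indexed by crossings, whereas \<open>sum_jumps\<close>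
    expects functions of the parameter.\<close>
  define R L where "R t = Lim (at_right t) F" and "L t = Lim (at_left t) F" for t
  have RL: "R (fst x) = R1 x" "L (fst x) = L1 x" "R (snd x) = R2 x" "L (snd x) = L2 x"
    if "x \<in> crossings D" for x
    unfolding R_def L_def using lim[OF that] by (auto intro!: tendsto_Lim tendsto_eventually)
  have fin: "finite crossing_params"
    using finite_crossings by (simp add: crossing_params_def)
  have params: "\<exists>x\<in>crossings D. t = fst x \<or> t = snd x" if "t \<in> crossing_params" for t
    using that by (auto simp: crossing_params_def)
  have in01: "0 \<le> t" "t < 1" if t: "t \<in> crossing_params" for t
    using params[OF t] crossingD(1,2) by fastforce+
  define M where "M = Max (insert 0 crossing_params)"
  have M: "0 \<le> M" "M < 1" "\<And>t. t \<in> crossing_params \<Longrightarrow> t \<le> M"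
    using fin in01 by (auto simp: M_def)
  \<comment> \<open>The midpoint of \<open>M - 1\<close> and 0: the period from \<open>a\<close> to
    \<open>a + 1\<close> contains all crossing parameters in its interior, even if 0 is one of
    them.\<close>
  define a where "a = (M - 1) / 2"
  have a: "a < 0" "M < a + 1" "M - 1 < a" using M by (auto simp: a_def field_simps)
  have "(\<Sum>t\<in>crossing_params. R t - L t) = F (a + 1) - F a"
  proof (rule sum_jumps[where F = F and a = a and b = "a + 1", OF fin])
    show "crossing_params \<subseteq> {a<..<a + 1}" using a M in01 by fastforce
    show "eventually (\<lambda>\<tau>. F \<tau> = F t) (nhds t)" if t: "t \<in> {a..a + 1} - crossing_params" for t
    proof (rule const)
      show "regular t"
      proof (rule ccontr)
        assume "\<not> regular t"
        then obtain x where x: "x \<in> crossings D" "\<gamma> t = \<gamma> (fst x)" by (auto simp: regular_def)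
        then obtain k :: int where "t - of_int k \<in> {fst x, snd x}"
          using crossing_preimages[of "fst x" "snd x"] by (auto simp: preimages_def)
        then have k: "t - of_int k \<in> crossing_params" using x by (auto simp: crossing_params_def)
        \<comment> \<open>A shift by a nonzero integer moves a parameter from [0,M] out of the
          period from \<open>a\<close> to \<open>a + 1\<close>.\<close>
        have "k = 0"
        proof (rule ccontr)
          assume "k \<noteq> 0"
          then have "k \<ge> 1 \<or> k \<le> - 1" by linarith
          then have "real_of_int k \<ge> 1 \<or> real_of_int k \<le> - 1" by linarith
          then show False using in01[OF k] M(3)[OF k] t a by auto
        qed
        then show False using k t by simp
      qed
    qed
    show "eventually (\<lambda>\<tau>. F \<tau> = R t) (at_right t)" "eventually (\<lambda>\<tau>. F \<tau> = L t) (at_left t)"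
      if "t \<in> crossing_params" for t
      using params[OF that] lim RL by auto
  qed simp
  then have "(\<Sum>t\<in>crossing_params. R t - L t) = 0" by (simp add: F)
  then show ?thesis
    unfolding sum_crossing_params using RL by (simp cong: sum.cong)
qed

lemma unshaded_column_zero:
  assumes S: "checkerboard_coloring D S" and BC: "B \<in> S" "C \<notin> S"
  shows "(\<Sum>x\<in>crossings D. goeritz_index D S x * dehn_coeff D x B * dehn_coeff D x C) = 0"
proof -
  have "(\<Sum>x\<in>crossings D. real_of_int (goeritz_index D S x * dehn_coeff D x B * dehn_coeff D x C)) = 0"
    using sum_jumps_crossings[of "border_at B C", OF _ _ border_limits]
      jump_at_crossing[OF S _ BC] border_periodic border_locally_constant
    by (simp cong: sum.cong)
  then have "real_of_int (\<Sum>x\<in>crossings D. goeritz_index D S x * dehn_coeff D x B * dehn_coeff D x C) = 0"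
    by (simp only: of_int_sum)
  then show ?thesis by (simp only: of_int_eq_0_iff)
qed


section \<open>The signed row sums\<close>

lemma sign_to_eq:
  assumes "a = 1 \<or> a = - 1" and "c = 1 \<or> c = - 1"
  shows "sign_to a c = a * c"
  unfolding sign_to_def by (rule the_equality) (use assms in auto)

text \<open>In a shaded column all entries are 0, 1 or -1, so the required sign is minus the product
  of entry and Goeritz index. Rows with entry 0 contribute nothing to the product form, so the sum
  extends to all crossings.\<close>

lemma signed_row_sum_index:
  assumes S: "checkerboard_coloring D S" and Xs: "distinct Xs" "set Xs = crossings D"
    and "j < length Rs" "k < length Rs" "Rs ! j \<in> S"
  shows "signed_row_sum D S Xs Rs j $ k =
    - (\<Sum>x\<in>crossings D. goeritz_index D S x * dehn_coeff D x (Rs ! j) * dehn_coeff D x (Rs ! k))"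
proof -
  let ?g = "goeritz_index D S" and ?d = "dehn_coeff D"
  have "signed_row_sum D S Xs Rs j $ k = (\<Sum>i | i < length Xs \<and> ?d (Xs ! i) (Rs ! j) \<noteq> 0.
      sign_to (?d (Xs ! i) (Rs ! j)) (- ?g (Xs ! i)) * ?d (Xs ! i) (Rs ! k))"
    using assms by (auto simp: signed_row_sum_def Let_def dehn_matrix_def intro!: sum.cong)
  also have "\<dots> = (\<Sum>i | i < length Xs \<and> ?d (Xs ! i) (Rs ! j) \<noteq> 0.
      - (?g (Xs ! i) * ?d (Xs ! i) (Rs ! j) * ?d (Xs ! i) (Rs ! k)))"
  proof (rule sum.cong[OF refl])
    fix i assume i: "i \<in> {i. i < length Xs \<and> ?d (Xs ! i) (Rs ! j) \<noteq> 0}"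
    then have x: "Xs ! i \<in> crossings D" using Xs nth_mem by blast
    then have "?d (Xs ! i) (Rs ! j) = 1 \<or> ?d (Xs ! i) (Rs ! j) = - 1"
      using dehn_coeff_shaded(1)[OF S x assms(6)] i by auto
    then show "sign_to (?d (Xs ! i) (Rs ! j)) (- ?g (Xs ! i)) * ?d (Xs ! i) (Rs ! k) =
        - (?g (Xs ! i) * ?d (Xs ! i) (Rs ! j) * ?d (Xs ! i) (Rs ! k))"
      using goeritz_index_cases[of S "Xs ! i"] by (subst sign_to_eq) auto
  qed
  also have "\<dots> = (\<Sum>i<length Xs. - (?g (Xs ! i) * ?d (Xs ! i) (Rs ! j) * ?d (Xs ! i) (Rs ! k)))"
    by (rule sum.mono_neutral_left) auto
  also have "\<dots> = (\<Sum>x\<in>crossings D. - (?g x * ?d x (Rs ! j) * ?d x (Rs ! k)))"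
    using bij_betw_nth[OF Xs(1) refl Xs(2)[symmetric]] by (rule sum.reindex_bij_betw)
  finally show ?thesis by (simp add: sum_negf)
qed

lemma goeritz_coeff_eq:
  assumes S: "checkerboard_coloring D S" and "B \<in> S" "C \<in> S" "B \<noteq> C"
  shows "goeritz_coeff D S B C =
    - (\<Sum>x\<in>crossings D. goeritz_index D S x * dehn_coeff D x B * dehn_coeff D x C)"
proof -
  have "goeritz_coeff D S B C = (\<Sum>x\<in>crossings D.
      of_bool (B \<in> corner_regions D x \<and> C \<in> corner_regions D x) * goeritz_index D S x)"
    unfolding goeritz_coeff_def
    by (rule sum.mono_neutral_cong_left) (use finite_crossings in auto)
  also have "\<dots> = (\<Sum>x\<in>crossings D. - (goeritz_index D S x * dehn_coeff D x B * dehn_coeff D x C))"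
    using dehn_coeff_shaded(2)[OF S _ assms(2-4)] by (intro sum.cong) (auto simp: mult.assoc)
  finally show ?thesis by (simp add: sum_negf)
qed

text \<open>The shaded entries of each row of the Dehn matrix add up to 0, so the term for
  \<open>C = B\<close> is minus the sum of the terms for the other shaded regions.\<close>

lemma goeritz_diagonal:
  assumes S: "checkerboard_coloring D S" and "finite S" "B \<in> S"
  shows "(\<Sum>C\<in>S - {B}. goeritz_coeff D S B C) =
    (\<Sum>x\<in>crossings D. goeritz_index D S x * dehn_coeff D x B * dehn_coeff D x B)"
proof -
  let ?q = "\<lambda>C x. goeritz_index D S x * dehn_coeff D x B * dehn_coeff D x C"
  have "(\<Sum>C\<in>S. \<Sum>x\<in>crossings D. ?q C x) =
      (\<Sum>x\<in>crossings D. goeritz_index D S x * dehn_coeff D x B * (\<Sum>C\<in>S. dehn_coeff D x C))"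
    by (subst sum.swap) (simp add: sum_distrib_left)
  also have "\<dots> = 0"
    using dehn_coeff_shaded(3)[OF S _ assms(2)] by simp
  finally have "(\<Sum>x\<in>crossings D. ?q B x) = - (\<Sum>C\<in>S - {B}. \<Sum>x\<in>crossings D. ?q C x)"
    using assms(2,3) by (simp add: sum.remove)
  moreover have "(\<Sum>C\<in>S - {B}. goeritz_coeff D S B C) = (\<Sum>C\<in>S - {B}. - (\<Sum>x\<in>crossings D. ?q C x))"
    using goeritz_coeff_eq[OF S assms(3)] by (intro sum.cong) auto
  ultimately show ?thesis by (simp add: sum_negf)
qed

end

section \<open>Comparison with the Goeritz matrix\<close>

lemma pick_lessThan: "i < n \<Longrightarrow> pick {..<n} i = i"
  using pick_card_in_set[of i "{..<n}"] by (simp add: Collect_conj_eq lessThan_def[symmetric] Int_absorb1)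

theorem theorem1:
  fixes D :: knot_diagram
    and S :: "complex set set"
    and Xs :: "(real \<times> real) list"
    and Rs :: "complex set list"
    and b m :: nat
    and N G :: "int mat"
  assumes "oriented_knot_diagram D"
    and "checkerboard_coloring D S"
    and "distinct Xs" and "set Xs = crossings D"
    and "distinct Rs" and "set Rs = regions D"
    and "m = card (regions D)" and "b = card S"
    and "set (take b Rs) = S"
    and "N = mat_of_rows m (map (signed_row_sum D S Xs Rs) [0..<b])"
    and "G = goeritz_matrix D S (take b Rs)"
  shows "submatrix N {..<b} {..<b} = G \<and>
         (\<forall>j < b. \<forall>k. b \<le> k \<and> k < m \<longrightarrow> N $$ (j, k) = 0)"
proof -
  interpret diagram D by unfold_locales (rule assms(1))
  note S = assms(2)
  have m: "m = length Rs" using assms(5-7) distinct_card by metis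
  have "S \<subseteq> set Rs" using S assms(6) by (auto simp: checkerboard_coloring_def)
  \<comment> \<open>This ensures that \<open>take b Rs\<close> has length exactly
    \<open>b\<close>.\<close>
  then have b: "b \<le> m" using assms(6-8) by (metis List.finite_set card_mono)
  have finS: "finite S" using assms(9) by auto
  have inS: "Rs ! j \<in> S" if "j < b" for j
    using that assms(9) b m nth_mem[of j "take b Rs"] by auto
  have notinS: "Rs ! k \<notin> S" if k: "b \<le> k" "k < m" for k
  proof
    assume "Rs ! k \<in> S"
    then obtain i where "i < b" "Rs ! i = Rs ! k"
      using assms(9) b m by (auto simp: in_set_conv_nth)
    then show False using assms(5) k m nth_eq_iff_index_eq[of Rs i k] by auto
  qed
  have N: "N $$ (j, k) =
      - (\<Sum>x\<in>crossings D. goeritz_index D S x * dehn_coeff D x (Rs ! j) * dehn_coeff D x (Rs ! k))"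
    if "j < b" "k < m" for j k
    using that b signed_row_sum_index[OF S assms(3,4) _ _ inS, of j k]
    by (simp add: assms(10) mat_of_rows_index m)
  have dims: "dim_row N = b" "dim_col N = m" by (simp_all add: assms(10))
  have "submatrix N {..<b} {..<b} = G"
  proof (rule eq_matI)
    have card: "card {i. i < b \<and> i \<in> {..<b}} = b" "card {i. i < m \<and> i \<in> {..<b}} = b"
    proof -
      have "{i. i < b \<and> i \<in> {..<b}} = {..<b}" "{i. i < m \<and> i \<in> {..<b}} = {..<b}" using b by auto
      then show "card {i. i < b \<and> i \<in> {..<b}} = b" "card {i. i < m \<and> i \<in> {..<b}} = b" by simp_all
    qed
    have lb: "length (take b Rs) = b" "min (length Rs) b = b" using b m by simp_all
    show "dim_row (submatrix N {..<b} {..<b}) = dim_row G" "dim_col (submatrix N {..<b} {..<b}) = dim_col G"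
      using card lb by (simp_all add: dim_submatrix dims assms(11) goeritz_matrix_def)
    fix i j assume "i < dim_row G" "j < dim_col G"
    then have ij: "i < b" "j < b" using lb by (simp_all add: assms(11) goeritz_matrix_def)
    have "submatrix N {..<b} {..<b} $$ (i, j) = N $$ (i, j)"
      using card ij by (simp add: submatrix_index dims pick_lessThan)
    also have "\<dots> = G $$ (i, j)"
    proof (cases "i = j")
      case False
      then have "Rs ! i \<noteq> Rs ! j" using ij b m assms(5) by (simp add: nth_eq_iff_index_eq)
      then show ?thesis
        using False ij b goeritz_coeff_eq[OF S inS inS, of i j]
        by (simp add: N assms(11) goeritz_matrix_def lb)
    next
      case True
      \<comment> \<open>\<open>goeritz_matrix\<close> sums over list positions,
        \<open>goeritz_diagonal\<close> over the regions themselves.\<close>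
      have "bij_betw (\<lambda>l. Rs ! l) ({..<b} - {i}) (S - {Rs ! i})"
      proof (rule bij_betw_imageI)
        show "inj_on (\<lambda>l. Rs ! l) ({..<b} - {i})"
          using assms(5) b m by (auto intro!: inj_onI simp: nth_eq_iff_index_eq)
        have "(\<lambda>l. Rs ! l) ` {..<b} = S"
          using nth_image[of b Rs] assms(9) b m by (simp add: atLeast0LessThan)
        then show "(\<lambda>l. Rs ! l) ` ({..<b} - {i}) = S - {Rs ! i}"
          using assms(5) b m ij by (auto simp: nth_eq_iff_index_eq)
      qed
      then have "(\<Sum>l \<in> {..<b} - {i}. goeritz_coeff D S (Rs ! i) (Rs ! l)) =
          (\<Sum>C \<in> S - {Rs ! i}. goeritz_coeff D S (Rs ! i) C)"
        by (rule sum.reindex_bij_betw)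
      then have "G $$ (i, i) = - (\<Sum>C \<in> S - {Rs ! i}. goeritz_coeff D S (Rs ! i) C)"
        using ij lb by (simp add: assms(11) goeritz_matrix_def)
      then show ?thesis
        using True ij b goeritz_diagonal[OF S finS inS[OF ij(1)]] by (simp add: N)
    qed
    finally show "submatrix N {..<b} {..<b} $$ (i, j) = G $$ (i, j)" .
  qed
  moreover have "N $$ (j, k) = 0" if "j < b" "b \<le> k" "k < m" for j k
    using that N unshaded_column_zero[OF S inS notinS] by simp
  ultimately show ?thesis by blast
qed

end
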